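(* Let $\zeta,q$ (on $\mathcal E$, with $h=1+\varepsilon\zeta>0$) and $q_i=q_i(t)$ be regular and satisfy $$\partial_t\zeta+\partial_xq=0,\qquad (1-\widetilde\mu^2\partial_x^2)\partial_tq+\varepsilon\partial_x\Big(\frac{q^2}{h}\Big)+h\,\partial_x\zeta=0\qquad\text{in }\mathcal E,$$ with $(\zeta,q)\to(0,0)$ as $x\to-\infty$, $q=0$ at $x=\ell$, and $\llbracket q\rrbracket=0$, $\langle q\rangle=q_i$. Then the evolution equation $$\alpha\frac{dq_i}{dt}=-\llbracket\zeta+\mathfrak E\rrbracket-P_0(I-\kappa\mathcal D)\overline\zeta,\qquad \mathfrak E=\varepsilon\frac{q^2}{2h^2}-\widetilde\mu^2\frac{\partial_x\partial_tq}{h},$$ can be equivalently reformulated as the following nonlinear first-order ODEs: for $\widetilde\mu=0$, $$\alpha\frac{dq_i}{dt}+\frac\varepsilon2\Big\llbracket\frac1{h^2}\Big\rrbracket q_i^2=-\llbracket\zeta\rrbracket-P_0(I-\kappa\mathcal D)\overline\zeta;$$ and for $\widetilde\mu\neq0$, $$\big(\alpha+\mathcal T_{\widetilde\mu}(h)\big)\frac{dq_i}{dt}-\frac\varepsilon2\Big\llbracket\frac1{h^2}\Big\rrbracket q_i^2=-\llbracket\mathcal F\rrbracket-P_0(I-\kappa\mathcal D)\overline\zeta,$$ where $$\mathcal T_{\widetilde\mu}(h)=\widetilde\mu\Big(C_{1,\widetilde\mu}\Big\langle\frac1h\Big\rangle+C_{2,\widetilde\mu}\Big\llbracket\frac1h\Big\rrbracket\Big)>0,\qquad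 C_{1,\widetilde\mu}=\frac{e^{\frac{\ell-r}{\widetilde\mu}}}{\sinh(\frac{\ell-r}{\widetilde\mu})},\qquad C_{2,\widetilde\mu}=\frac{e^{-\frac{\ell-r}{\widetilde\mu}}}{2\sinh(\frac{\ell-r}{\widetilde\mu})},$$ and $$\mathcal F=\frac1h\Big(\varepsilon\frac{\zeta^2}2+R_1\varphi\Big),\qquad \varphi=\zeta+\varepsilon\frac{\zeta^2}2+\varepsilon\frac{q^2}h .$$
   Context: Parameters: $\varepsilon\in(0,1]$, $\widetilde\mu\ge0$, $0<r<\ell$, $\alpha=2r/h_{\rm w}$ with a constant $h_{\rm w}>0$, $P_0>0$, $\kappa\ge0$. Domains: $\mathcal E_-=(-\infty,-r)$, $\mathcal E_+=(r,\ell)$, $\mathcal E=\mathcal E_-\cup\mathcal E_+$, $|\mathcal E_+|=\ell-r$. For a function $G$ on $\mathcal E$ with traces at $\pm r$: $\llbracket G\rrbracket=G(r)-G(-r)$, $\langle G\rangle=\frac{G(r)+G(-r)}2$. $\overline\zeta(t)=\frac1{|\mathcal E_+|}\int_{\mathcal E_+}\zeta(t,x)\,dx$; $I$ is the identity; $\mathcal Df(t)=\int_0^te^{-\kappa(t-s)}f(s)\,ds$. For $\widetilde\mu>0$, $R_1$ is the inverse of $I-\widetilde\mu^2\partial_x^2$ on $\mathcal E$ with homogeneous Neumann conditions: $u=R_1v$ iff $(I-\widetilde\mu^2\partial_x^2)u=v$ in $\mathcal E$, $\partial_xu\to0$ as $x\to-\infty$, and $\partial_xu=0$ at $x=\pm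 r$ and at $x=\ell$ (solved on each connected component, in the class of functions in $L^2$-based Sobolev spaces). "Regular" means sufficiently smooth up to the boundary on each of $\mathcal E_\pm$ and sufficiently decaying at $-\infty$. *)

theory Defs
  imports "HOL-Analysis.Analysis"
begin

text \<open>The exterior domain. Functions on it are rendered as functions on the whole real line
  whose values outside the (open) set \<open>E r l\<close> never matter; boundary values are one-sided limits.\<close>

definition Em :: "real \<Rightarrow> real set" where "Em r = {..<-r}"
definition Ep :: "real \<Rightarrow> real \<Rightarrow> real set" where "Ep r l = {r<..<l}"
definition E :: "real \<Rightarrow> real \<Rightarrow> real set" where "E r l = Em r \<union> Ep r l"

definition jump :: "real \<Rightarrow> (real \<Rightarrow> real) \<Rightarrow> real" where
  "jump r G = Lim (at_right r) G - Lim (at_left (-r)) G"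

definition mean :: "real \<Rightarrow> (real \<Rightarrow> real) \<Rightarrow> real" where
  "mean r G = (Lim (at_right r) G + Lim (at_left (-r)) G) / 2"

text \<open>Partial derivatives; the time derivative is one-sided at the end points of the time
  interval \<open>J\<close>.\<close>

definition dt :: "real set \<Rightarrow> (real \<Rightarrow> real \<Rightarrow> real) \<Rightarrow> real \<Rightarrow> real \<Rightarrow> real" where
  "dt J f t x = vector_derivative (\<lambda>s. f s x) (at t within J)"

definition dx :: "(real \<Rightarrow> real \<Rightarrow> real) \<Rightarrow> real \<Rightarrow> real \<Rightarrow> real" where
  "dx f t x = deriv (f t) x"

definition sq_integrable :: "real set \<Rightarrow> (real \<Rightarrow> real) \<Rightarrow> bool" where
  "sq_integrable I f \<longleftrightarrow>
     set_borel_measurable lborel I f \<and> set_integrable lborel I (\<lambda>x. (f x)\<^sup>2)"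

definition cont_to_bdry :: "real set \<Rightarrow> real set \<Rightarrow> (real \<Rightarrow> real \<Rightarrow> real) \<Rightarrow> bool" where
  "cont_to_bdry J I g \<longleftrightarrow>
     (\<exists>G. continuous_on (J \<times> closure I) (\<lambda>(t, x). G t x) \<and> (\<forall>t\<in>J. \<forall>x\<in>I. G t x = g t x))"

definition cont_decaying ::
  "real set \<Rightarrow> real \<Rightarrow> real \<Rightarrow> (real \<Rightarrow> real \<Rightarrow> real) \<Rightarrow> bool" where
  "cont_decaying J r l g \<longleftrightarrow>
     cont_to_bdry J (Em r) g \<and> cont_to_bdry J (Ep r l) g \<and>
     (\<forall>t\<in>J. sq_integrable (Em r) (g t) \<and> (g t \<longlongrightarrow> 0) at_bot)"

text \<open>Regularity: first order in \<open>(t,x)\<close>; the second predicate adds the two \<open>x\<close>-derivatives of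
  the time derivative that enter the dispersive terms.\<close>

definition regular :: "real set \<Rightarrow> real \<Rightarrow> real \<Rightarrow> (real \<Rightarrow> real \<Rightarrow> real) \<Rightarrow> bool" where
  "regular J r l f \<longleftrightarrow>
     (\<forall>t\<in>J. \<forall>x\<in>E r l. (\<lambda>s. f s x) differentiable (at t within J) \<and> f t differentiable (at x)) \<and>
     cont_decaying J r l f \<and> cont_decaying J r l (dt J f) \<and> cont_decaying J r l (dx f)"

definition regular_disp :: "real set \<Rightarrow> real \<Rightarrow> real \<Rightarrow> (real \<Rightarrow> real \<Rightarrow> real) \<Rightarrow> bool" where
  "regular_disp J r l f \<longleftrightarrow>
     (\<forall>t\<in>J. \<forall>x\<in>E r l. dt J f t differentiable (at x) \<and> dx (dt J f) t differentiable (at x)) \<and>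
     cont_decaying J r l (dx (dt J f)) \<and> cont_decaying J r l (dx (dx (dt J f)))"

text \<open>\<open>f \<in> H\<^sup>1(I)\<close> on an interval \<open>I\<close>, with weak derivative \<open>f'\<close>: \<open>f\<close> is the absolutely continuous
  representative.\<close>

definition H1_deriv :: "real set \<Rightarrow> (real \<Rightarrow> real) \<Rightarrow> (real \<Rightarrow> real) \<Rightarrow> bool" where
  "H1_deriv I f f' \<longleftrightarrow> sq_integrable I f \<and> sq_integrable I f' \<and>
     (\<forall>x\<in>I. \<forall>y\<in>I. x \<le> y \<longrightarrow> f y - f x = (LINT s:{x..y}|lborel. f' s))"

text \<open>\<open>H\<^sup>2\<close> solutions, on each component, of the Neumann problem for \<open>I - \<mu>\<^sup>2 \<partial>\<^sub>x\<^sup>2\<close>;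
  \<open>u1\<close> and \<open>u2\<close> are the first two derivatives of \<open>u\<close>. The normalisation \<open>u = 0\<close> off \<open>E r l\<close>
  makes \<open>u\<close> unique as a function on the real line.\<close>

definition neumann_solution ::
  "real \<Rightarrow> real \<Rightarrow> real \<Rightarrow> (real \<Rightarrow> real) \<Rightarrow> (real \<Rightarrow> real) \<Rightarrow> bool" where
  "neumann_solution \<mu> r l v u \<longleftrightarrow> (\<forall>x. x \<notin> E r l \<longrightarrow> u x = 0) \<and>
     (\<exists>u1 u2. (\<forall>I\<in>{Em r, Ep r l}. H1_deriv I u u1 \<and> H1_deriv I u1 u2) \<and>
        (AE x in lborel. x \<in> E r l \<longrightarrow> u x - \<mu>\<^sup>2 * u2 x = v x) \<and>
        (u1 \<longlongrightarrow> 0) at_bot \<and> (u1 \<longlongrightarrow> 0) (at_left (-r)) \<and>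
        (u1 \<longlongrightarrow> 0) (at_right r) \<and> (u1 \<longlongrightarrow> 0) (at_left l))"

definition R1 :: "real \<Rightarrow> real \<Rightarrow> real \<Rightarrow> (real \<Rightarrow> real) \<Rightarrow> real \<Rightarrow> real" where
  "R1 \<mu> r l v = (THE u. neumann_solution \<mu> r l v u)"

definition avg :: "real \<Rightarrow> real \<Rightarrow> (real \<Rightarrow> real \<Rightarrow> real) \<Rightarrow> real \<Rightarrow> real" where
  "avg r l \<zeta> t = 1 / (l - r) * integral (Ep r l) (\<zeta> t)"

definition D :: "real \<Rightarrow> (real \<Rightarrow> real) \<Rightarrow> real \<Rightarrow> real" where
  "D \<kappa> f t = integral {0..t} (\<lambda>s. exp (-\<kappa> * (t - s)) * f s)"

definition height :: "real \<Rightarrow> (real \<Rightarrow> real \<Rightarrow> real) \<Rightarrow> real \<Rightarrow> real \<Rightarrow> real" where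
  "height \<epsilon> \<zeta> t x = 1 + \<epsilon> * \<zeta> t x"

definition frakE :: "real set \<Rightarrow> real \<Rightarrow> real \<Rightarrow> (real \<Rightarrow> real \<Rightarrow> real) \<Rightarrow> (real \<Rightarrow> real \<Rightarrow> real)
    \<Rightarrow> real \<Rightarrow> real \<Rightarrow> real" where
  "frakE J \<epsilon> \<mu> \<zeta> q t x =
     \<epsilon> * ((q t x)\<^sup>2 / (2 * (height \<epsilon> \<zeta> t x)\<^sup>2)) - \<mu>\<^sup>2 * (dx (dt J q) t x / height \<epsilon> \<zeta> t x)"

definition C1 :: "real \<Rightarrow> real \<Rightarrow> real \<Rightarrow> real" where
  "C1 \<mu> r l = exp ((l - r) / \<mu>) / sinh ((l - r) / \<mu>)"

definition C2 :: "real \<Rightarrow> real \<Rightarrow> real \<Rightarrow> real" where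
  "C2 \<mu> r l = exp (- ((l - r) / \<mu>)) / (2 * sinh ((l - r) / \<mu>))"

definition calT :: "real \<Rightarrow> real \<Rightarrow> real \<Rightarrow> (real \<Rightarrow> real) \<Rightarrow> real" where
  "calT \<mu> r l h =
     \<mu> * (C1 \<mu> r l * mean r (\<lambda>x. 1 / h x) + C2 \<mu> r l * jump r (\<lambda>x. 1 / h x))"

definition phi :: "real \<Rightarrow> (real \<Rightarrow> real \<Rightarrow> real) \<Rightarrow> (real \<Rightarrow> real \<Rightarrow> real) \<Rightarrow> real \<Rightarrow> real \<Rightarrow> real"
  where
  "phi \<epsilon> \<zeta> q t x = \<zeta> t x + \<epsilon> * ((\<zeta> t x)\<^sup>2 / 2) + \<epsilon> * ((q t x)\<^sup>2 / height \<epsilon> \<zeta> t x)"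

definition calF :: "real \<Rightarrow> real \<Rightarrow> real \<Rightarrow> real \<Rightarrow> (real \<Rightarrow> real \<Rightarrow> real) \<Rightarrow> (real \<Rightarrow> real \<Rightarrow> real)
    \<Rightarrow> real \<Rightarrow> real \<Rightarrow> real" where
  "calF \<epsilon> \<mu> r l \<zeta> q t x =
     1 / height \<epsilon> \<zeta> t x * (\<epsilon> * ((\<zeta> t x)\<^sup>2 / 2) + R1 \<mu> r l (phi \<epsilon> \<zeta> q t) x)"

end

theory Submission
  imports Defs
begin

text \<open>For \<open>\<mu> = 0\<close> the traces of \<open>q\<close> at \<open>\<plusminus>r\<close> are both \<open>q\<^sub>i\<close>, which gives the claim at once. For
  \<open>\<mu> \<noteq> 0\<close> the momentum equation reads \<open>p - \<mu>\<^sup>2 p'' = -\<phi>'\<close> for \<open>p = \<partial>\<^sub>tq\<close>, whose traces are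
  \<open>dq\<^sub>i/dt\<close> at \<open>\<plusminus>r\<close> and \<open>0\<close> at \<open>l\<close>. If \<open>z\<close> is the decaying solution of \<open>z = \<mu>\<^sup>2 z''\<close> with these
  traces, then \<open>R\<^sub>1\<phi> = \<phi> + \<mu>\<^sup>2 (z' - p')\<close>, so the traces of \<open>p'\<close> in the jump condition can be
  replaced by those of \<open>R\<^sub>1\<phi>\<close> and of the explicit \<open>z'\<close>; the latter produce the added mass
  \<open>\<mu> (coth((l - r)/\<mu>)/h(r) + 1/h(-r)) dq\<^sub>i/dt\<close>.\<close>

text \<open>The momentum equation and the traces force an identity between jumps, and each
  equivalence follows by inserting it. The function \<open>phi\<close> is a primitive of the
  non-dispersive part of the momentum equation, because \<open>h * dx \<zeta>\<close> is the
  derivative of \<zeta> + \<epsilon> \<zeta>^2 / 2. It carries the full \<epsilon> q^2 / h, so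
  \<open>calF\<close> contains \<epsilon> q^2 / h^2 where \<open>frakE\<close> has only half of it.
  Half is therefore to be subtracted again, which is why the quadratic term has opposite signs in
  the two cases. Two obstacles shape the proof. \<open>R1\<close> is a definite description over
  weak solutions, so the formula for it is worth nothing without uniqueness; weak solutions are
  upgraded to classical ones, for which the homogeneous equation is solved by exponentials. Moreover
  the transmission and wall conditions concern q, while the Dirichlet data needed are those of its
  time derivative, so limits in x and derivatives in t have to be exchanged.\<close>

lemma open_components: "I \<in> {Em r, Ep r l} \<Longrightarrow> open I \<and> is_interval I"
  by (auto simp: Em_def Ep_def is_interval_def)

section \<open>Square-integrable functions on the two components\<close>

lemma sq_integrable_bound:
  assumes f: "sq_integrable I f" and g: "set_borel_measurable lborel I g"
    and le: "\<And>x. x \<in> I \<Longrightarrow> \<bar>g x\<bar> \<le> C * \<bar>f x\<bar>"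
  shows "sq_integrable I g"
  unfolding sq_integrable_def
proof
  have "integrable lborel (\<lambda>x. C\<^sup>2 * (indicator I x *\<^sub>R (f x)\<^sup>2))"
    using f by (simp add: sq_integrable_def set_integrable_def)
  moreover have "(\<lambda>x. indicator I x *\<^sub>R (g x)\<^sup>2) \<in> borel_measurable lborel"
  proof -
    have "(\<lambda>x. (indicator I x *\<^sub>R g x)\<^sup>2) \<in> borel_measurable lborel"
      using g unfolding set_borel_measurable_def by (rule borel_measurable_power)
    moreover have "(indicator I x *\<^sub>R g x)\<^sup>2 = indicator I x *\<^sub>R (g x)\<^sup>2" for x
      by (auto simp: indicator_def)
    ultimately show ?thesis by simp
  qed
  moreover have "norm (indicator I x *\<^sub>R (g x)\<^sup>2) \<le> norm (C\<^sup>2 * (indicator I x *\<^sub>R (f x)\<^sup>2))" for x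
    using power_mono[OF le, of x 2] by (auto simp: indicator_def power_mult_distrib)
  ultimately show "set_integrable lborel I (\<lambda>x. (g x)\<^sup>2)"
    unfolding set_integrable_def by (rule Bochner_Integration.integrable_bound[OF _ _ AE_I2])
qed (fact g)

lemma sq_integrable_add:
  assumes "sq_integrable I f" "sq_integrable I g"
  shows "sq_integrable I (\<lambda>x. f x + g x)"
  unfolding sq_integrable_def
proof
  have "(\<lambda>x. indicator I x *\<^sub>R f x + indicator I x *\<^sub>R g x) \<in> borel_measurable lborel"
    using assms unfolding sq_integrable_def set_borel_measurable_def
    by (intro borel_measurable_add) auto
  then show m: "set_borel_measurable lborel I (\<lambda>x. f x + g x)"
    by (simp only: set_borel_measurable_def scaleR_add_right)
  have "integrable lborel (\<lambda>x. 2 * (indicator I x *\<^sub>R (f x)\<^sup>2) + 2 * (indicator I x *\<^sub>R (g x)\<^sup>2))"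
    using assms by (simp add: sq_integrable_def set_integrable_def)
  moreover have "(\<lambda>x. indicator I x *\<^sub>R (f x + g x)\<^sup>2) \<in> borel_measurable lborel"
  proof -
    have "(\<lambda>x. (indicator I x *\<^sub>R (f x + g x))\<^sup>2) \<in> borel_measurable lborel"
      using m unfolding set_borel_measurable_def by (rule borel_measurable_power)
    moreover have "(indicator I x *\<^sub>R (f x + g x))\<^sup>2 = indicator I x *\<^sub>R (f x + g x)\<^sup>2" for x
      by (auto simp: indicator_def)
    ultimately show ?thesis by simp
  qed
  moreover have "norm (indicator I x *\<^sub>R (f x + g x)\<^sup>2)
      \<le> norm (2 * (indicator I x *\<^sub>R (f x)\<^sup>2) + 2 * (indicator I x *\<^sub>R (g x)\<^sup>2))" for x
    using sum_squares_bound[of "f x" "g x"] zero_le_power2[of "f x + g x"]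
    by (auto simp: indicator_def power2_sum)
  ultimately show "set_integrable lborel I (\<lambda>x. (f x + g x)\<^sup>2)"
    unfolding set_integrable_def by (rule Bochner_Integration.integrable_bound[OF _ _ AE_I2])
qed

text \<open>The device for nonlinear terms: a product stays square integrable when one factor is
  bounded, so a quadratic expression is split into a bounded coefficient and a square-integrable
  function.\<close>

lemma sq_integrable_mult_bounded:
  assumes f: "sq_integrable I f" and g: "set_borel_measurable lborel I g"
    and le: "\<And>x. x \<in> I \<Longrightarrow> \<bar>g x\<bar> \<le> C"
  shows "sq_integrable I (\<lambda>x. g x * f x)"
proof (rule sq_integrable_bound[OF f])
  have "(\<lambda>x. (indicator I x *\<^sub>R g x) * (indicator I x *\<^sub>R f x)) \<in> borel_measurable lborel"
    using f g unfolding set_borel_measurable_def sq_integrable_def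
    by (intro borel_measurable_times) auto
  moreover have "(\<lambda>x. (indicator I x *\<^sub>R g x) * (indicator I x *\<^sub>R f x))
      = (\<lambda>x. indicator I x *\<^sub>R (g x * f x))"
    by (auto simp: indicator_def)
  ultimately show "set_borel_measurable lborel I (\<lambda>x. g x * f x)"
    by (simp only: set_borel_measurable_def)
  show "\<bar>g x * f x\<bar> \<le> C * \<bar>f x\<bar>" if "x \<in> I" for x
    using le[OF that] by (simp add: abs_mult mult_right_mono)
qed

lemma sq_integrable_cmult: "sq_integrable I f \<Longrightarrow> sq_integrable I (\<lambda>x. c * f x)"
  by (rule sq_integrable_bound[of I f _ "\<bar>c\<bar>"])
    (auto simp: sq_integrable_def set_borel_measurable_def abs_mult mult.left_commute[of _ c])

lemma sq_integrable_diff: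
  "sq_integrable I f \<Longrightarrow> sq_integrable I g \<Longrightarrow> sq_integrable I (\<lambda>x. f x - g x)"
  using sq_integrable_add[of I f "\<lambda>x. -1 * g x"] sq_integrable_cmult[of I g "-1"] by simp

lemma sq_integrable_cong:
  assumes "\<And>x. x \<in> I \<Longrightarrow> f x = g x"
  shows "sq_integrable I f \<longleftrightarrow> sq_integrable I g"
proof -
  have "indicator I x *\<^sub>R f x = indicator I x *\<^sub>R g x"
    "indicator I x *\<^sub>R (f x)\<^sup>2 = indicator I x *\<^sub>R (g x)\<^sup>2" for x
    using assms by (auto simp: indicator_def)
  then show ?thesis
    by (simp only: sq_integrable_def set_borel_measurable_def set_integrable_def)
qed

lemma set_borel_measurable_continuous_on:
  fixes f :: "real \<Rightarrow> real"
  assumes "open I" "continuous_on I f"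
  shows "set_borel_measurable lborel I f"
  using borel_measurable_continuous_on_indicator[of I f] assms
  by (simp add: set_borel_measurable_def)

text \<open>The component has finite length, so the constant 1 is square integrable and
  \<open>f\<close> is a bounded multiple of it.\<close>

lemma sq_integrable_Ep_bounded:
  assumes "continuous_on (Ep r l) f" and le: "\<And>x. x \<in> Ep r l \<Longrightarrow> \<bar>f x\<bar> \<le> C"
  shows "sq_integrable (Ep r l) f"
proof -
  have "sq_integrable (Ep r l) (\<lambda>x. 1)"
    by (auto simp: sq_integrable_def set_integrable_def set_borel_measurable_def Ep_def
        emeasure_lborel_box_finite[of r l, simplified])
  from sq_integrable_mult_bounded[OF this, of f C] assms show ?thesis
    by (simp add: set_borel_measurable_continuous_on Ep_def)
qed

lemma tendsto_exp_over_at_bot: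
  assumes "0 < \<mu>"
  shows "((\<lambda>x. exp (x / \<mu>)) \<longlongrightarrow> (0::real)) at_bot"
  using filterlim_compose[OF exp_at_bot filterlim_tendsto_pos_mult_at_bot[OF tendsto_const _
        filterlim_ident, of "1 / \<mu>"]] assms by simp

text \<open>The square is exp(2x/\<mu>), which is nonnegative and has a primitive vanishing at minus
  infinity, so the fundamental theorem on an unbounded interval yields integrability.\<close>

lemma sq_integrable_exp_Em:
  assumes "0 < \<mu>"
  shows "sq_integrable (Em r) (\<lambda>x. exp (x / \<mu>))"
proof -
  have "set_integrable lborel (einterval (-\<infinity>) (ereal (-r))) (\<lambda>x. exp (2 * x / \<mu>))"
  proof (rule interval_integral_FTC_nonneg(1))
    show "((\<lambda>x. \<mu> / 2 * exp (2 * x / \<mu>)) has_real_derivative exp (2 * x / \<mu>)) (at x)" for x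
      using assms by (auto intro!: derivative_eq_intros simp: field_simps)
    have "((\<lambda>x. \<mu> / 2 * exp (2 * x / \<mu>)) \<longlongrightarrow> 0) at_bot"
      using tendsto_mult_right_zero[OF tendsto_exp_over_at_bot[of "\<mu> / 2"], of "\<mu> / 2"] assms
      by (simp add: mult.commute)
    then show "(((\<lambda>x. \<mu> / 2 * exp (2 * x / \<mu>)) \<circ> real_of_ereal) \<longlongrightarrow> 0) (at_right (-\<infinity>))"
      by (simp add: ereal_tendsto_simps)
    show "(((\<lambda>x. \<mu> / 2 * exp (2 * x / \<mu>)) \<circ> real_of_ereal) \<longlongrightarrow> \<mu> / 2 * exp (2 * (-r) / \<mu>))
      (at_left (ereal (-r)))"
      using assms by (subst ereal_tendsto_simps1) (intro tendsto_intros, auto)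
  qed (use assms in \<open>auto intro!: continuous_intros\<close>)
  moreover have "einterval (-\<infinity>) (ereal (-r)) = Em r"
    by (auto simp: einterval_def Em_def)
  moreover have "(exp (x / \<mu>))\<^sup>2 = exp (2 * x / \<mu>)" for x
    by (simp flip: exp_double)
  ultimately show ?thesis
    unfolding sq_integrable_def using assms
    by (auto intro!: set_borel_measurable_continuous_on continuous_intros simp: Em_def)
qed

text \<open>On a set of finite measure the bound |f| \<le> f^2 + 1 suffices. It makes the integrals
  of weak derivatives over compact subintervals meaningful.\<close>

lemma sq_integrable_imp_integrable:
  fixes f :: "real \<Rightarrow> real"
  assumes f: "sq_integrable I f" and sub: "{a..b} \<subseteq> I"
  shows "set_integrable lborel {a..b} f"
proof -
  have "set_integrable lborel {a..b} (\<lambda>x. (f x)\<^sup>2)"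
    by (rule set_integrable_subset[of _ I]) (use assms in \<open>auto simp: sq_integrable_def\<close>)
  moreover have "set_integrable lborel {a..b} (\<lambda>x. 1::real)"
    by (intro borel_integrable_atLeastAtMost') auto
  ultimately have "integrable lborel
      (\<lambda>x. indicator {a..b} x *\<^sub>R (f x)\<^sup>2 + indicator {a..b} x *\<^sub>R (1::real))"
    unfolding set_integrable_def by simp
  moreover have "(\<lambda>x. indicator {a..b} x *\<^sub>R f x) \<in> borel_measurable lborel"
    using set_borel_measurable_subset[of lborel I f "{a..b}"] f sub
    by (simp add: sq_integrable_def set_borel_measurable_def)
  moreover have "\<bar>f x\<bar> \<le> (f x)\<^sup>2 + 1" for x
    using sum_squares_bound[of "\<bar>f x\<bar>" 1] by simp
  ultimately show ?thesis
    unfolding set_integrable_def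
    by (elim Bochner_Integration.integrable_bound) (auto simp: indicator_def)
qed

section \<open>From weak derivatives to classical ones and back\<close>

lemma interior_interval:
  fixes I :: "real set"
  assumes "open I" "is_interval I" "x \<in> I"
  obtains a b where "a < x" "x < b" "{a..b} \<subseteq> I"
proof -
  obtain e where "e > 0" "cball x e \<subseteq> I"
    using assms open_contains_cball by blast
  then show ?thesis
    by (intro that[of "x - e" "x + e"]) (auto simp: cball_eq_atLeastAtMost)
qed

lemma H1_deriv_continuous_on:
  assumes I: "open I" "is_interval I" and H: "H1_deriv I f f'"
  shows "continuous_on I f"
  unfolding continuous_on_eq_continuous_at[OF I(1)]
proof
  fix x assume "x \<in> I"
  then obtain a b where ab: "a < x" "x < b" "{a..b} \<subseteq> I"
    using interior_interval[OF I] by blast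
  have int: "set_integrable lborel {a..y} f'" if "y \<le> b" for y
    using sq_integrable_imp_integrable[of I f' a y] H ab that by (force simp: H1_deriv_def)
  have "continuous_on {a..b} (\<lambda>y. f a + integral {a..y} f')"
    using set_borel_integral_eq_integral(1)[OF int[of b]]
    by (intro continuous_intros indefinite_integral_continuous_1) auto
  moreover have "f a + integral {a..y} f' = f y" if "y \<in> {a..b}" for y
  proof -
    have "f y - f a = (LINT s:{a..y}|lborel. f' s)"
      using H that ab(1,2) subsetD[OF ab(3), of a] subsetD[OF ab(3), of y]
      unfolding H1_deriv_def by simp
    then show ?thesis
      using set_borel_integral_eq_integral(2)[OF int[of y]] that by simp
  qed
  ultimately have "continuous_on {a..b} f"
    by (metis (no_types, lifting) continuous_on_cong)
  then show "isCont f x"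
    using ab continuous_on_interior[of "{a..b}" f x] by (simp add: interior_atLeastAtMost_real)
qed

text \<open>The bootstrap step: increments of \<open>f\<close> are integrals of \<open>f'\<close>,
  which do not see a null set, so \<open>f'\<close> may be replaced by its continuous version
  \<open>g\<close> and the fundamental theorem applies.\<close>

lemma H1_deriv_has_derivative:
  assumes I: "open I" "is_interval I" and H: "H1_deriv I f f'"
    and g: "continuous_on I g" and ae: "AE x in lborel. x \<in> I \<longrightarrow> f' x = g x" and x: "x \<in> I"
  shows "(f has_real_derivative g x) (at x)"
proof -
  obtain a b where ab: "a < x" "x < b" "{a..b} \<subseteq> I"
    using interior_interval[OF I x] by blast
  have gab: "continuous_on {a..b} g"
    using g ab continuous_on_subset by blast
  have eq: "f y = f a + integral {a..y} g" if y: "y \<in> {a..b}" for y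
  proof -
    have fi: "set_integrable lborel {a..y} f'"
      using sq_integrable_imp_integrable[of I f' a y] H ab y by (force simp: H1_deriv_def)
    have gi: "set_integrable lborel {a..y} g"
      using gab y by (intro borel_integrable_atLeastAtMost') (auto elim: continuous_on_subset)
    have "f y - f a = (LINT s:{a..y}|lborel. f' s)"
      using H y ab(1,2) subsetD[OF ab(3), of a] subsetD[OF ab(3), of y]
      unfolding H1_deriv_def by simp
    also have "\<dots> = (LINT s:{a..y}|lborel. g s)"
      unfolding set_lebesgue_integral_def
    proof (rule integral_cong_AE)
      show "AE s in lborel. indicator {a..y} s *\<^sub>R f' s = indicator {a..y} s *\<^sub>R g s"
        using ae by (rule AE_mp) (use ab y in \<open>force intro!: AE_I2 simp: indicator_def\<close>)
    qed (use fi gi in \<open>auto simp: set_integrable_def\<close>)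
    also have "\<dots> = integral {a..y} g"
      by (rule set_borel_integral_eq_integral(2)[OF gi])
    finally show ?thesis by simp
  qed
  have "((\<lambda>y. f a + integral {a..y} g) has_vector_derivative (0 + g x)) (at x within {a..b})"
    using gab ab by (intro has_vector_derivative_add integral_has_vector_derivative
        has_vector_derivative_const) auto
  then have "(f has_vector_derivative g x) (at x within {a..b})"
    using ab by (intro has_vector_derivative_transform[OF _ eq]) auto
  then show ?thesis
    using at_within_interior[of x "{a..b}"] ab
    by (simp add: has_real_derivative_iff_has_vector_derivative interior_atLeastAtMost_real)
qed

text \<open>The converse passage, needed to certify an explicit candidate as a weak solution. Being
  an interval, \<open>I\<close> contains every segment over which the derivative is
  integrated.\<close>

lemma H1_deriv_C1:
  assumes I: "open I" "is_interval I"
    and f: "\<And>x. x \<in> I \<Longrightarrow> (f has_real_derivative f' x) (at x)" and f': "continuous_on I f'"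
    and "sq_integrable I f" "sq_integrable I f'"
  shows "H1_deriv I f f'"
proof -
  have "f y - f x = (LINT s:{x..y}|lborel. f' s)" if "x \<in> I" "y \<in> I" "x \<le> y" for x y
  proof -
    have sub: "{x..y} \<subseteq> I"
      using I(2) that unfolding is_interval_1 by (meson atLeastAtMost_iff subsetI)
    show ?thesis
      unfolding set_lebesgue_integral_def
    proof (rule integral_FTC_atLeastAtMost[symmetric])
      show "(f has_vector_derivative f' s) (at s within {x..y})" if "x \<le> s" "s \<le> y" for s
        using f[of s] subsetD[OF sub, of s] that
        by (simp add: has_real_derivative_iff_has_vector_derivative has_vector_derivative_at_within)
    qed (use \<open>x \<le> y\<close> sub f' in \<open>auto elim: continuous_on_subset\<close>)
  qed
  then show ?thesis
    using assms by (simp add: H1_deriv_def)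
qed

section \<open>Uniqueness for the Neumann problem\<close>

lemma constant_on_component:
  fixes A :: "real \<Rightarrow> real"
  assumes I: "open I" "is_interval I"
    and "\<And>x. x \<in> I \<Longrightarrow> (A has_real_derivative 0) (at x)"
  obtains c where "\<And>x. x \<in> I \<Longrightarrow> A x = c"
proof -
  have "A constant_on I"
    using assms by (intro has_field_derivative_0_imp_constant_on)
      (auto simp: is_interval_connected)
  then show ?thesis
    using that by (auto simp: constant_on_def)
qed

text \<open>The combinations \<open>d \<plusminus> \<mu> d'\<close> satisfy first order equations, which avoids an energy estimate.\<close>

lemma homogeneous_solution:
  fixes d d1 :: "real \<Rightarrow> real"
  assumes I: "open I" "is_interval I" and \<mu>: "0 < \<mu>"
    and d: "\<And>x. x \<in> I \<Longrightarrow> (d has_real_derivative d1 x) (at x)"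
      "\<And>x. x \<in> I \<Longrightarrow> (d1 has_real_derivative d x / \<mu>\<^sup>2) (at x)"
  obtains A B where
    "\<And>x. x \<in> I \<Longrightarrow> d x = A * exp (x / \<mu>) + B * exp (- x / \<mu>)"
    "\<And>x. x \<in> I \<Longrightarrow> d1 x = A / \<mu> * exp (x / \<mu>) - B / \<mu> * exp (- x / \<mu>)"
proof -
  have e: "((\<lambda>x. exp (- x / \<mu>)) has_real_derivative - exp (- x / \<mu>) / \<mu>) (at x)"
    "((\<lambda>x. exp (x / \<mu>)) has_real_derivative exp (x / \<mu>) / \<mu>) (at x)" for x
    using \<mu> by (auto intro!: derivative_eq_intros)
  \<comment> \<open>The sum s = d + \<mu> d' satisfies s' = s / \<mu>, hence this integrating
    factor; the difference satisfies the equation with the opposite sign and takes the reciprocal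
    factor.\<close>
  have "((\<lambda>x. exp (- x / \<mu>) * (d x + \<mu> * d1 x)) has_real_derivative 0) (at x)" if "x \<in> I" for x
    by (rule DERIV_cong[OF DERIV_mult'[OF e(1) DERIV_add[OF d(1) DERIV_cmult[OF d(2)]]]])
      (use that \<mu> in \<open>auto simp: field_simps power2_eq_square\<close>)
  then obtain a where a: "\<And>x. x \<in> I \<Longrightarrow> exp (- x / \<mu>) * (d x + \<mu> * d1 x) = a"
    using constant_on_component[OF I] by blast
  have "((\<lambda>x. exp (x / \<mu>) * (d x - \<mu> * d1 x)) has_real_derivative 0) (at x)" if "x \<in> I" for x
    by (rule DERIV_cong[OF DERIV_mult'[OF e(2) DERIV_diff[OF d(1) DERIV_cmult[OF d(2)]]]])
      (use that \<mu> in \<open>auto simp: field_simps power2_eq_square\<close>)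
  then obtain b where b: "\<And>x. x \<in> I \<Longrightarrow> exp (x / \<mu>) * (d x - \<mu> * d1 x) = b"
    using constant_on_component[OF I] by blast
  have "d x + \<mu> * d1 x = a * exp (x / \<mu>)" "d x - \<mu> * d1 x = b * exp (- x / \<mu>)" if "x \<in> I" for x
    using a[OF that] b[OF that] by (auto simp: exp_minus field_simps)
  then have "2 * d x = a * exp (x / \<mu>) + b * exp (- x / \<mu>)"
    "2 * (\<mu> * d1 x) = a * exp (x / \<mu>) - b * exp (- x / \<mu>)" if "x \<in> I" for x
    using that by force+
  then have "d x = a / 2 * exp (x / \<mu>) + b / 2 * exp (- x / \<mu>)"
    "d1 x = a / 2 / \<mu> * exp (x / \<mu>) - b / 2 / \<mu> * exp (- x / \<mu>)" if "x \<in> I" for x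
    using that \<mu> by (simp_all add: field_simps)
  then show ?thesis
    using that by blast
qed

text \<open>Solved for \<open>u2\<close>, the equation expresses it almost everywhere through
  \<open>u\<close> and \<open>v\<close>, both continuous. Hence \<open>u1\<close> has a classical
  derivative, and \<open>u\<close> as well because \<open>u1\<close> is itself continuous.\<close>

lemma neumann_solution_has_derivatives:
  assumes u: "neumann_solution \<mu> r l v u" and \<mu>: "0 < \<mu>" and v: "continuous_on (E r l) v"
  obtains u1 where
    "\<And>x. x \<in> E r l \<Longrightarrow> (u has_real_derivative u1 x) (at x)"
    "\<And>x. x \<in> E r l \<Longrightarrow> (u1 has_real_derivative (u x - v x) / \<mu>\<^sup>2) (at x)"
    "(u1 \<longlongrightarrow> 0) at_bot" "(u1 \<longlongrightarrow> 0) (at_left (-r))"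
    "(u1 \<longlongrightarrow> 0) (at_right r)" "(u1 \<longlongrightarrow> 0) (at_left l)"
proof -
  obtain u1 u2 where K: "(\<forall>I\<in>{Em r, Ep r l}. H1_deriv I u u1 \<and> H1_deriv I u1 u2) \<and>
      (AE x in lborel. x \<in> E r l \<longrightarrow> u x - \<mu>\<^sup>2 * u2 x = v x) \<and>
      (u1 \<longlongrightarrow> 0) at_bot \<and> (u1 \<longlongrightarrow> 0) (at_left (-r)) \<and>
      (u1 \<longlongrightarrow> 0) (at_right r) \<and> (u1 \<longlongrightarrow> 0) (at_left l)"
    using conjunct2[OF u[unfolded neumann_solution_def]] by (elim exE) (rule that)
  then have H: "\<And>I. I \<in> {Em r, Ep r l} \<Longrightarrow> H1_deriv I u u1 \<and> H1_deriv I u1 u2"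
    and eq: "AE x in lborel. x \<in> E r l \<longrightarrow> u x - \<mu>\<^sup>2 * u2 x = v x"
    and lim: "(u1 \<longlongrightarrow> 0) at_bot" "(u1 \<longlongrightarrow> 0) (at_left (-r))"
      "(u1 \<longlongrightarrow> 0) (at_right r)" "(u1 \<longlongrightarrow> 0) (at_left l)"
    by auto
  have "(u has_real_derivative u1 x) (at x) \<and>
      (u1 has_real_derivative (u x - v x) / \<mu>\<^sup>2) (at x)" if x: "x \<in> E r l" for x
  proof -
    obtain I where I: "I \<in> {Em r, Ep r l}" "x \<in> I"
      using x unfolding E_def by blast
    then have I': "open I" "is_interval I" "I \<subseteq> E r l"
      using open_components[of I r l] by (auto simp: E_def)
    have cont: "continuous_on I u" "continuous_on I u1"
      using H[OF I(1)] H1_deriv_continuous_on[OF I'(1,2)] by auto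
    have "AE x in lborel. x \<in> I \<longrightarrow> u2 x = (u x - v x) / \<mu>\<^sup>2"
      using eq by (rule AE_mp) (use \<mu> I'(3) in \<open>force simp: field_simps intro!: AE_I2\<close>)
    moreover have "continuous_on I (\<lambda>x. (u x - v x) / \<mu>\<^sup>2)"
      using \<mu> by (intro continuous_intros cont continuous_on_subset[OF v I'(3)]) auto
    ultimately have "(u1 has_real_derivative (u x - v x) / \<mu>\<^sup>2) (at x)"
      using H[OF I(1)] I(2) by (intro H1_deriv_has_derivative[OF I'(1,2)]) auto
    moreover have "(u has_real_derivative u1 x) (at x)"
      using H[OF I(1)] I(2) cont by (intro H1_deriv_has_derivative[OF I'(1,2)]) auto
    ultimately show ?thesis by simp
  qed
  then show ?thesis
    by (intro that[of u1] lim) auto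
qed

lemma eventually_components:
  assumes "r < l"
  shows "eventually (\<lambda>x. x \<in> Em r) at_bot" "eventually (\<lambda>x. x \<in> Em r) (at_left (-r))"
    "eventually (\<lambda>x. x \<in> Ep r l) (at_right r)" "eventually (\<lambda>x. x \<in> Ep r l) (at_left l)"
proof -
  show "eventually (\<lambda>x. x \<in> Em r) at_bot"
    unfolding Em_def eventually_at_bot_dense by blast
  show "eventually (\<lambda>x. x \<in> Em r) (at_left (-r))"
    by (simp add: Em_def eventually_at_filter)
  show "eventually (\<lambda>x. x \<in> Ep r l) (at_right r)" "eventually (\<lambda>x. x \<in> Ep r l) (at_left l)"
    unfolding Ep_def using assms by (rule eventually_at_right_real, rule eventually_at_left_real)
qed

lemma eventually_E:
  assumes "r < l"
  shows "eventually (\<lambda>x. x \<in> E r l) at_bot" "eventually (\<lambda>x. x \<in> E r l) (at_left (-r))"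
    "eventually (\<lambda>x. x \<in> E r l) (at_right r)" "eventually (\<lambda>x. x \<in> E r l) (at_left l)"
  by (rule eventually_mono[OF eventually_components(1)[OF assms]]
      eventually_mono[OF eventually_components(2)[OF assms]]
      eventually_mono[OF eventually_components(3)[OF assms]]
      eventually_mono[OF eventually_components(4)[OF assms]]; simp add: E_def)+

text \<open>The premise \<open>L = L'\<close> lets the limit be produced by the limit rules in raw
  form and simplified afterwards.\<close>

lemma tendsto_eq_on:
  assumes "(g \<longlongrightarrow> L) F" "\<And>x. x \<in> S \<Longrightarrow> f x = g x" "eventually (\<lambda>x. x \<in> S) F" "L = L'"
  shows "(f \<longlongrightarrow> L') F"
  unfolding assms(4)[symmetric]
  by (rule Lim_transform_eventually[OF assms(1)], rule eventually_mono[OF assms(3)])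
    (simp add: assms(2))

text \<open>On each component \<open>d\<close> combines two exponentials, and two conditions on
  \<open>d1\<close> remove both coefficients. On the half-line, decay excludes the exponential that
  blows up at minus infinity and the condition at -r excludes the other. On the bounded component
  the conditions at the two ends are independent because r < l.\<close>

lemma neumann_homogeneous_zero:
  fixes d d1 :: "real \<Rightarrow> real"
  assumes \<mu>: "0 < \<mu>" and rl: "r < l"
    and d: "\<And>x. x \<in> E r l \<Longrightarrow> (d has_real_derivative d1 x) (at x)"
      "\<And>x. x \<in> E r l \<Longrightarrow> (d1 has_real_derivative d x / \<mu>\<^sup>2) (at x)"
    and lim: "(d1 \<longlongrightarrow> 0) at_bot" "(d1 \<longlongrightarrow> 0) (at_left (-r))"
      "(d1 \<longlongrightarrow> 0) (at_right r)" "(d1 \<longlongrightarrow> 0) (at_left l)"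
    and x: "x \<in> E r l"
  shows "d x = 0"
proof -
  let ?w = "\<lambda>A B x. A / \<mu> * exp (x / \<mu>) - B / \<mu> * exp (- x / \<mu>)"
  have w: "(?w A B \<longlongrightarrow> ?w A B a) (at a within S)" for A B a S
    by (intro tendsto_intros) (use \<mu> in auto)
  have lin: "?w A B a = 0 \<Longrightarrow> A * exp (2 * a / \<mu>) = B" for A B a
    using \<mu> exp_double[of "a / \<mu>"] by (simp add: field_simps exp_minus power2_eq_square)
  from x consider "x \<in> Em r" | "x \<in> Ep r l" by (auto simp: E_def)
  then show ?thesis
  proof cases
    case 1
    obtain A B where AB: "\<And>x. x \<in> Em r \<Longrightarrow> d x = A * exp (x / \<mu>) + B * exp (- x / \<mu>)"
      "\<And>x. x \<in> Em r \<Longrightarrow> d1 x = ?w A B x"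
      using homogeneous_solution[of "Em r" \<mu> d d1] d \<mu> open_components[of "Em r" r l]
      by (auto simp: E_def)
    note ebot = tendsto_exp_over_at_bot[OF \<mu>]
    \<comment> \<open>Multiplication by the decaying exponential turns the growing term of
      \<open>d1\<close> into the constant -B / \<mu>, which can then be read off as a limit.\<close>
    have "((\<lambda>x. exp (x / \<mu>) * d1 x) \<longlongrightarrow> 0 * 0) at_bot"
      by (intro tendsto_mult ebot lim)
    moreover have "eventually (\<lambda>x. exp (x / \<mu>) * d1 x
        = A / \<mu> * (exp (x / \<mu>) * exp (x / \<mu>)) - B / \<mu>) at_bot"
      using eventually_components(1)[OF rl]
      by (rule eventually_mono) (use \<mu> in \<open>simp add: AB field_simps exp_minus\<close>)
    ultimately have "((\<lambda>x. A / \<mu> * (exp (x / \<mu>) * exp (x / \<mu>)) - B / \<mu>) \<longlongrightarrow> 0) at_bot"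
      by (auto intro: Lim_transform_eventually)
    moreover have "((\<lambda>x. A / \<mu> * (exp (x / \<mu>) * exp (x / \<mu>)) - B / \<mu>)
        \<longlongrightarrow> A / \<mu> * (0 * 0) - B / \<mu>) at_bot"
      by (intro tendsto_intros ebot)
    ultimately have "0 = A / \<mu> * (0 * 0) - B / \<mu>"
      by (rule tendsto_unique[rotated]) simp
    then have "B = 0" using \<mu> by simp
    moreover have "?w A B (-r) = 0"
      using Lim_transform_eventually[OF lim(2), of "?w A B"] w[of A B "-r" "{..<-r}"] AB
        eventually_mono[OF eventually_components(2)[OF rl]]
      by (intro tendsto_unique[of "at_left (-r)" "?w A B"]) auto
    ultimately have "A = 0" using \<mu> by simp
    with \<open>B = 0\<close> 1 AB show ?thesis by simp
  next
    case 2
    obtain A B where AB: "\<And>x. x \<in> Ep r l \<Longrightarrow> d x = A * exp (x / \<mu>) + B * exp (- x / \<mu>)"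
      "\<And>x. x \<in> Ep r l \<Longrightarrow> d1 x = ?w A B x"
      using homogeneous_solution[of "Ep r l" \<mu> d d1] d \<mu> open_components[of "Ep r l" r l]
      by (auto simp: E_def)
    have "?w A B r = 0"
      using Lim_transform_eventually[OF lim(3), of "?w A B"] w[of A B "r" "{r<..}"] AB
        eventually_mono[OF eventually_components(3)[OF rl]]
      by (intro tendsto_unique[of "at_right r" "?w A B"]) auto
    moreover have "?w A B l = 0"
      using Lim_transform_eventually[OF lim(4), of "?w A B"] w[of A B "l" "{..<l}"] AB
        eventually_mono[OF eventually_components(4)[OF rl]]
      by (intro tendsto_unique[of "at_left l" "?w A B"]) auto
    ultimately have "A * exp (2 * r / \<mu>) = B" "A * exp (2 * l / \<mu>) = B"
      using lin by blast+
    then have "A = 0" "B = 0"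
      using rl \<mu> by (auto simp: divide_simps)
    with 2 AB show ?thesis by simp
  qed
qed

lemma neumann_solution_unique:
  assumes u: "neumann_solution \<mu> r l v u" and w: "neumann_solution \<mu> r l v w"
    and \<mu>: "0 < \<mu>" and rl: "r < l" and v: "continuous_on (E r l) v"
  shows "u = w"
proof
  fix x
  show "u x = w x"
  proof (cases "x \<in> E r l")
    case False
    then show ?thesis using u w by (simp add: neumann_solution_def)
  next
    case True
    obtain u1 where u1:
      "\<And>x. x \<in> E r l \<Longrightarrow> (u has_real_derivative u1 x) (at x)"
      "\<And>x. x \<in> E r l \<Longrightarrow> (u1 has_real_derivative (u x - v x) / \<mu>\<^sup>2) (at x)"
      "(u1 \<longlongrightarrow> 0) at_bot" "(u1 \<longlongrightarrow> 0) (at_left (-r))"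
      "(u1 \<longlongrightarrow> 0) (at_right r)" "(u1 \<longlongrightarrow> 0) (at_left l)"
      using neumann_solution_has_derivatives[OF u \<mu> v] by metis
    obtain w1 where w1:
      "\<And>x. x \<in> E r l \<Longrightarrow> (w has_real_derivative w1 x) (at x)"
      "\<And>x. x \<in> E r l \<Longrightarrow> (w1 has_real_derivative (w x - v x) / \<mu>\<^sup>2) (at x)"
      "(w1 \<longlongrightarrow> 0) at_bot" "(w1 \<longlongrightarrow> 0) (at_left (-r))"
      "(w1 \<longlongrightarrow> 0) (at_right r)" "(w1 \<longlongrightarrow> 0) (at_left l)"
      using neumann_solution_has_derivatives[OF w \<mu> v] by metis
    have "u x - w x = 0"
    proof (rule neumann_homogeneous_zero[OF \<mu> rl, of "\<lambda>x. u x - w x" "\<lambda>x. u1 x - w1 x" x])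
      fix y assume y: "y \<in> E r l"
      show "((\<lambda>x. u x - w x) has_real_derivative u1 y - w1 y) (at y)"
        using u1(1)[OF y] w1(1)[OF y] by (rule DERIV_diff)
      show "((\<lambda>x. u1 x - w1 x) has_real_derivative (u y - w y) / \<mu>\<^sup>2) (at y)"
        using DERIV_diff[OF u1(2)[OF y] w1(2)[OF y]] by (simp add: diff_divide_distrib)
    qed (use True u1 w1 tendsto_diff[of _ 0 _ _ 0] in \<open>simp_all\<close>)
    then show ?thesis by simp
  qed
qed

section \<open>The Dirichlet lift and the evaluation of \<open>R1\<close>\<close>

lemma neumann_solutionI:
  assumes "\<And>x. x \<notin> E r l \<Longrightarrow> u x = 0"
    and "\<And>I. I \<in> {Em r, Ep r l} \<Longrightarrow> H1_deriv I u u1" "\<And>I. I \<in> {Em r, Ep r l} \<Longrightarrow> H1_deriv I u1 u2"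
    and "\<And>x. x \<in> E r l \<Longrightarrow> u x - \<mu>\<^sup>2 * u2 x = v x"
    and "(u1 \<longlongrightarrow> 0) at_bot" "(u1 \<longlongrightarrow> 0) (at_left (-r))"
    and "(u1 \<longlongrightarrow> 0) (at_right r)" "(u1 \<longlongrightarrow> 0) (at_left l)"
  shows "neumann_solution \<mu> r l v u"
proof -
  have "(\<forall>I\<in>{Em r, Ep r l}. H1_deriv I u u1 \<and> H1_deriv I u1 u2) \<and>
      (AE x in lborel. x \<in> E r l \<longrightarrow> u x - \<mu>\<^sup>2 * u2 x = v x) \<and>
      (u1 \<longlongrightarrow> 0) at_bot \<and> (u1 \<longlongrightarrow> 0) (at_left (-r)) \<and>
      (u1 \<longlongrightarrow> 0) (at_right r) \<and> (u1 \<longlongrightarrow> 0) (at_left l)"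
    using assms by simp
  then show ?thesis
    unfolding neumann_solution_def using assms(1) by blast
qed

lemma R1_eq:
  assumes "neumann_solution \<mu> r l v u" "0 < \<mu>" "r < l" "continuous_on (E r l) v"
  shows "R1 \<mu> r l v = u"
  unfolding R1_def
  by (rule the_equality) (use assms in \<open>auto intro: neumann_solution_unique\<close>)

text \<open>The decaying solution of \<open>z = \<mu>\<^sup>2 z''\<close> with \<open>z(\<plusminus>r) = c\<close> and \<open>z(l) = 0\<close>.\<close>

definition dirichlet_lift :: "real \<Rightarrow> real \<Rightarrow> real \<Rightarrow> real \<Rightarrow> real \<Rightarrow> real" where
  "dirichlet_lift \<mu> r l c x =
     (if x < -r then c * exp ((x + r) / \<mu>) else c * sinh ((l - x) / \<mu>) / sinh ((l - r) / \<mu>))"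

text \<open>Written in closed form because its one-sided values at -r and r are the source of
  \<open>calT\<close>.\<close>

definition dirichlet_lift' :: "real \<Rightarrow> real \<Rightarrow> real \<Rightarrow> real \<Rightarrow> real \<Rightarrow> real" where
  "dirichlet_lift' \<mu> r l c x =
     (if x < -r then c / \<mu> * exp ((x + r) / \<mu>)
      else - (c / \<mu>) * cosh ((l - x) / \<mu>) / sinh ((l - r) / \<mu>))"

lemma dirichlet_lift_derivatives:
  assumes \<mu>: "0 < \<mu>" and r: "0 < r" "r < l" and x: "x \<in> E r l"
  shows "(dirichlet_lift \<mu> r l c has_real_derivative dirichlet_lift' \<mu> r l c x) (at x)"
    "(dirichlet_lift' \<mu> r l c has_real_derivative dirichlet_lift \<mu> r l c x / \<mu>\<^sup>2) (at x)"
proof -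
  have s: "sinh ((l - r) / \<mu>) \<noteq> 0"
    using \<mu> r(2) by simp
  \<comment> \<open>The right component is enlarged to an open half-line on which the
    \<open>else\<close> branch is valid throughout, so derivatives transfer from the plain
    formulas.\<close>
  from x consider "x \<in> {..<-r}" | "x \<in> {-r<..}"
    using r by (auto simp: E_def Em_def Ep_def)
  then have "(dirichlet_lift \<mu> r l c has_real_derivative dirichlet_lift' \<mu> r l c x) (at x) \<and>
    (dirichlet_lift' \<mu> r l c has_real_derivative dirichlet_lift \<mu> r l c x / \<mu>\<^sup>2) (at x)"
  proof cases
    case 1
    have "((\<lambda>x. c * exp ((x + r) / \<mu>)) has_real_derivative dirichlet_lift' \<mu> r l c x) (at x)"
      "((\<lambda>x. c / \<mu> * exp ((x + r) / \<mu>)) has_real_derivative dirichlet_lift \<mu> r l c x / \<mu>\<^sup>2) (at x)"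
      using 1 \<mu> by (auto intro!: derivative_eq_intros
          simp: dirichlet_lift_def dirichlet_lift'_def power2_eq_square)
    then show ?thesis
      by (intro conjI; elim has_field_derivative_transform_within_open[OF _ open_lessThan 1])
        (auto simp: dirichlet_lift_def dirichlet_lift'_def)
  next
    case 2
    have "((\<lambda>x. c * sinh ((l - x) / \<mu>) / sinh ((l - r) / \<mu>)) has_real_derivative
        dirichlet_lift' \<mu> r l c x) (at x)"
      "((\<lambda>x. - (c / \<mu>) * cosh ((l - x) / \<mu>) / sinh ((l - r) / \<mu>)) has_real_derivative
        dirichlet_lift \<mu> r l c x / \<mu>\<^sup>2) (at x)"
      using 2 \<mu> s by (auto intro!: derivative_eq_intros
          simp: dirichlet_lift_def dirichlet_lift'_def power2_eq_square mult.commute mult.left_commute)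
    then show ?thesis
      by (intro conjI; elim has_field_derivative_transform_within_open[OF _ open_greaterThan 2])
        (auto simp: dirichlet_lift_def dirichlet_lift'_def)
  qed
  then show "(dirichlet_lift \<mu> r l c has_real_derivative dirichlet_lift' \<mu> r l c x) (at x)"
    "(dirichlet_lift' \<mu> r l c has_real_derivative dirichlet_lift \<mu> r l c x / \<mu>\<^sup>2) (at x)" by auto
qed

lemma dirichlet_lift_limits:
  assumes \<mu>: "0 < \<mu>" and r: "0 < r" "r < l"
  shows "(dirichlet_lift \<mu> r l c \<longlongrightarrow> 0) at_bot"
    "(dirichlet_lift \<mu> r l c \<longlongrightarrow> c) (at_left (-r))"
    "(dirichlet_lift \<mu> r l c \<longlongrightarrow> c) (at_right r)"
    "(dirichlet_lift \<mu> r l c \<longlongrightarrow> 0) (at_left l)"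
    "(dirichlet_lift' \<mu> r l c \<longlongrightarrow> c / \<mu>) (at_left (-r))"
    "(dirichlet_lift' \<mu> r l c \<longlongrightarrow> - (c / \<mu>) * cosh ((l - r) / \<mu>) / sinh ((l - r) / \<mu>)) (at_right r)"
proof -
  have s: "sinh ((l - r) / \<mu>) \<noteq> 0"
    using \<mu> r(2) by simp
  have m: "dirichlet_lift \<mu> r l c x = c * exp (r / \<mu>) * exp (x / \<mu>)"
    "dirichlet_lift' \<mu> r l c x = c / \<mu> * exp ((x + r) / \<mu>)" if "x \<in> Em r" for x
    using that by (auto simp: dirichlet_lift_def dirichlet_lift'_def Em_def add_divide_distrib exp_add)
  have p: "dirichlet_lift \<mu> r l c x = c * sinh ((l - x) / \<mu>) / sinh ((l - r) / \<mu>)"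
    "dirichlet_lift' \<mu> r l c x = - (c / \<mu>) * cosh ((l - x) / \<mu>) / sinh ((l - r) / \<mu>)"
    if "x \<in> Ep r l" for x
    using that r by (auto simp: dirichlet_lift_def dirichlet_lift'_def Ep_def)
  note ev = eventually_components[OF r(2)]
  have "((\<lambda>x. c * exp (r / \<mu>) * exp (x / \<mu>)) \<longlongrightarrow> c * exp (r / \<mu>) * 0) at_bot"
    by (intro tendsto_intros tendsto_exp_over_at_bot \<mu>)
  then show "(dirichlet_lift \<mu> r l c \<longlongrightarrow> 0) at_bot"
    by (rule tendsto_eq_on[OF _ m(1) ev(1)]) simp_all
  have "((\<lambda>x. c * exp (r / \<mu>) * exp (x / \<mu>)) \<longlongrightarrow> c * exp (r / \<mu>) * exp (- r / \<mu>)) (at_left (-r))"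
    by (intro tendsto_intros) (use \<mu> in auto)
  then show "(dirichlet_lift \<mu> r l c \<longlongrightarrow> c) (at_left (-r))"
    by (rule tendsto_eq_on[OF _ m(1) ev(2)]) (simp_all add: exp_minus)
  have "((\<lambda>x. c / \<mu> * exp ((x + r) / \<mu>)) \<longlongrightarrow> c / \<mu> * exp ((- r + r) / \<mu>)) (at_left (-r))"
    by (intro tendsto_intros) (use \<mu> in auto)
  then show "(dirichlet_lift' \<mu> r l c \<longlongrightarrow> c / \<mu>) (at_left (-r))"
    by (rule tendsto_eq_on[OF _ m(2) ev(2)]) simp_all
  have sl: "((\<lambda>x. c * sinh ((l - x) / \<mu>) / sinh ((l - r) / \<mu>)) \<longlongrightarrow>
      c * sinh ((l - a) / \<mu>) / sinh ((l - r) / \<mu>)) (at a within S)" for a S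
    by (intro tendsto_intros) (use \<mu> s in auto)
  show "(dirichlet_lift \<mu> r l c \<longlongrightarrow> c) (at_right r)"
    by (rule tendsto_eq_on[OF sl p(1) ev(3)]) (use s in auto)
  show "(dirichlet_lift \<mu> r l c \<longlongrightarrow> 0) (at_left l)"
    by (rule tendsto_eq_on[OF sl p(1) ev(4)]) auto
  have "((\<lambda>x. - (c / \<mu>) * cosh ((l - x) / \<mu>) / sinh ((l - r) / \<mu>)) \<longlongrightarrow>
      - (c / \<mu>) * cosh ((l - r) / \<mu>) / sinh ((l - r) / \<mu>)) (at_right r)"
    by (intro tendsto_intros) (use \<mu> s in auto)
  then show "(dirichlet_lift' \<mu> r l c \<longlongrightarrow> - (c / \<mu>) * cosh ((l - r) / \<mu>) / sinh ((l - r) / \<mu>)) (at_right r)"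
    by (rule tendsto_eq_on[OF _ p(2) ev(3)]) simp_all
qed

lemma dirichlet_lift_sq_integrable:
  assumes \<mu>: "0 < \<mu>" and r: "0 < r" "r < l" and I: "I \<in> {Em r, Ep r l}"
  shows "sq_integrable I (dirichlet_lift \<mu> r l c)" "sq_integrable I (dirichlet_lift' \<mu> r l c)"
proof -
  have "sq_integrable (Em r) (\<lambda>x. c * exp (r / \<mu>) * exp (x / \<mu>))"
    "sq_integrable (Em r) (\<lambda>x. c / \<mu> * exp (r / \<mu>) * exp (x / \<mu>))"
    by (intro sq_integrable_cmult sq_integrable_exp_Em \<mu>)+
  then have m: "sq_integrable (Em r) (dirichlet_lift \<mu> r l c)"
    "sq_integrable (Em r) (dirichlet_lift' \<mu> r l c)"
    by (subst sq_integrable_cong; force simp: dirichlet_lift_def dirichlet_lift'_def Em_def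
        add_divide_distrib exp_add mult.commute)+
  have bdd: "sq_integrable (Ep r l) f" if f: "continuous_on {r..l} f" for f :: "real \<Rightarrow> real"
  proof -
    have "bounded (f ` {r..l})"
      using compact_continuous_image[OF f] compact_imp_bounded by blast
    then obtain C where "\<And>x. x \<in> {r..l} \<Longrightarrow> \<bar>f x\<bar> \<le> C"
      unfolding bounded_iff by (metis imageI real_norm_def)
    moreover have "continuous_on (Ep r l) f"
      using f by (rule continuous_on_subset) (auto simp: Ep_def)
    ultimately show ?thesis
      by (intro sq_integrable_Ep_bounded[of r l f C]) (auto simp: Ep_def)
  qed
  have "sq_integrable (Ep r l) (\<lambda>x. c * sinh ((l - x) / \<mu>) / sinh ((l - r) / \<mu>))"
    "sq_integrable (Ep r l) (\<lambda>x. - (c / \<mu>) * cosh ((l - x) / \<mu>) / sinh ((l - r) / \<mu>))"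
    using \<mu> r(2) by (intro bdd continuous_intros ballI; simp)+
  then have "sq_integrable (Ep r l) (dirichlet_lift \<mu> r l c)"
    "sq_integrable (Ep r l) (dirichlet_lift' \<mu> r l c)"
    using r by (subst sq_integrable_cong; force simp: dirichlet_lift_def dirichlet_lift'_def Ep_def)+
  with m I show "sq_integrable I (dirichlet_lift \<mu> r l c)" "sq_integrable I (dirichlet_lift' \<mu> r l c)"
    by auto
qed

text \<open>With \<open>z\<close> the Dirichlet lift, \<open>u = v + \<mu>\<^sup>2 (z' - p')\<close> satisfies \<open>u' = z - p\<close>, which vanishes at the
  boundary; so existence of the Neumann solution needs no Green function.\<close>

lemma R1_from_dispersive:
  assumes \<mu>: "0 < \<mu>" and r: "0 < r" "r < l"
    and p: "\<And>x. x \<in> E r l \<Longrightarrow> (p has_real_derivative p1 x) (at x)"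
      "\<And>x. x \<in> E r l \<Longrightarrow> (p1 has_real_derivative p2 x) (at x)"
    and v: "\<And>x. x \<in> E r l \<Longrightarrow> (v has_real_derivative \<mu>\<^sup>2 * p2 x - p x) (at x)"
    and sq: "\<And>I. I \<in> {Em r, Ep r l} \<Longrightarrow> sq_integrable I p \<and> sq_integrable I p1 \<and> sq_integrable I v"
    and lim: "(p \<longlongrightarrow> 0) at_bot" "(p \<longlongrightarrow> c) (at_left (-r))" "(p \<longlongrightarrow> c) (at_right r)"
      "(p \<longlongrightarrow> 0) (at_left l)"
    and x: "x \<in> E r l"
  shows "R1 \<mu> r l v x = v x + \<mu>\<^sup>2 * (dirichlet_lift' \<mu> r l c x - p1 x)"
proof -
  define u where "u x = (if x \<in> E r l then v x + \<mu>\<^sup>2 * (dirichlet_lift' \<mu> r l c x - p1 x) else 0)" for x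
  let ?u1 = "\<lambda>x. dirichlet_lift \<mu> r l c x - p x"
  let ?u2 = "\<lambda>x. dirichlet_lift' \<mu> r l c x - p1 x"
  note z = dirichlet_lift_derivatives[OF \<mu> r] and zlim = dirichlet_lift_limits[OF \<mu> r]
  have "open (E r l)"
    by (auto simp: E_def Em_def Ep_def)
  have v_cont: "continuous_on (E r l) v"
    using v by (meson DERIV_continuous continuous_at_imp_continuous_on)
  have "neumann_solution \<mu> r l v u"
  proof (rule neumann_solutionI[where ?u1.0 = ?u1 and ?u2.0 = ?u2])
    show "u x = 0" if "x \<notin> E r l" for x
      using that by (simp add: u_def)
    show "u x - \<mu>\<^sup>2 * ?u2 x = v x" if "x \<in> E r l" for x
      using that by (simp add: u_def)
    have d1: "(?u1 has_real_derivative ?u2 x) (at x)" if "x \<in> E r l" for x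
      by (intro DERIV_diff z p that)
    have d: "(u has_real_derivative ?u1 x) (at x)" if "x \<in> E r l" for x
    proof -
      \<comment> \<open>The term \<mu>^2 \<open>p2\<close> from the derivative of \<open>v\<close>
        cancels against the one from \<open>p1\<close>, and \<mu>^2 times the second derivative of
        the lift is the lift itself; only lift minus \<open>p\<close> remains.\<close>
      have "((\<lambda>x. v x + \<mu>\<^sup>2 * (dirichlet_lift' \<mu> r l c x - p1 x)) has_real_derivative ?u1 x) (at x)"
        by (rule DERIV_cong[OF DERIV_add[OF v DERIV_cmult[OF DERIV_diff[OF z(2) p(2)]]]])
          (use that \<mu> in \<open>auto simp: field_simps\<close>)
      then show ?thesis
        by (rule has_field_derivative_transform_within_open[OF _ \<open>open (E r l)\<close> that])
          (simp add: u_def)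
    qed
    show "(?u1 \<longlongrightarrow> 0) at_bot" "(?u1 \<longlongrightarrow> 0) (at_left (-r))"
      "(?u1 \<longlongrightarrow> 0) (at_right r)" "(?u1 \<longlongrightarrow> 0) (at_left l)"
      using tendsto_diff[OF zlim(1) lim(1)] tendsto_diff[OF zlim(2) lim(2), of c]
        tendsto_diff[OF zlim(3) lim(3), of c] tendsto_diff[OF zlim(4) lim(4)]
      by simp_all
    fix I assume I: "I \<in> {Em r, Ep r l}"
    then have I': "open I" "is_interval I" "I \<subseteq> E r l"
      using open_components[of I r l] by (auto simp: E_def)
    have c1: "continuous_on I ?u1"
      using d1 I'(3) by (meson DERIV_continuous continuous_at_imp_continuous_on subsetD)
    have c2: "continuous_on I ?u2"
      using DERIV_diff[OF z(2) p(2)] I'(3)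
      by (meson DERIV_continuous continuous_at_imp_continuous_on subsetD)
    have s2: "sq_integrable I ?u2" and s1: "sq_integrable I ?u1"
      using sq[OF I] dirichlet_lift_sq_integrable[OF \<mu> r I] by (auto intro: sq_integrable_diff)
    have "sq_integrable I (\<lambda>x. v x + \<mu>\<^sup>2 * ?u2 x)"
      using sq[OF I] s2 by (intro sq_integrable_add sq_integrable_cmult) auto
    then have s0: "sq_integrable I u"
      using I'(3) by (subst sq_integrable_cong) (auto simp: u_def)
    show "H1_deriv I u ?u1" "H1_deriv I ?u1 ?u2"
      using H1_deriv_C1[OF I'(1,2)] d d1 c1 c2 s0 s1 s2 I'(3) by (meson subsetD)+
  qed
  from R1_eq[OF this \<mu> r(2) v_cont] x show ?thesis
    by (simp add: u_def)
qed

section \<open>Traces and bounds of regular functions\<close>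

lemma closure_Em: "closure (Em r) = {..-r}"
  by (simp add: Em_def)

lemma closure_Ep: "r < l \<Longrightarrow> closure (Ep r l) = {r..l}"
  by (simp add: Ep_def)

lemma at_within_Ep:
  assumes "r < l"
  shows "at r within Ep r l = at_right r" "at l within Ep r l = at_left l"
  by (rule at_within_nhd[of _ "{..<l}"]; use assms in \<open>auto simp: Ep_def\<close>)
    (rule at_within_nhd[of _ "{r<..}"]; use assms in \<open>auto simp: Ep_def\<close>)

text \<open>The limit is identified as a value of the extension, so that traces inherit its
  continuity in time.\<close>

lemma continuous_extension_tendsto:
  fixes G :: "real \<Rightarrow> real \<Rightarrow> real"
  assumes G: "continuous_on (J \<times> closure I) (\<lambda>(t, x). G t x)" "\<forall>t\<in>J. \<forall>x\<in>I. G t x = g t x"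
    and t: "t \<in> J" and a: "a \<in> closure I"
  shows "(g t \<longlongrightarrow> G t a) (at a within I)"
proof -
  have "continuous_on (closure I) (\<lambda>x. (\<lambda>(t, x). G t x) (t, x))"
    by (rule continuous_on_compose2[OF G(1)]) (use t in \<open>auto intro!: continuous_intros\<close>)
  then have "(G t \<longlongrightarrow> G t a) (at a within closure I)"
    using a by (simp add: continuous_on_def)
  then have "(G t \<longlongrightarrow> G t a) (at a within I)"
    by (rule tendsto_within_subset) (rule closure_subset)
  then show ?thesis
    by (rule Lim_transform_eventually) (use G(2) t in \<open>auto simp: eventually_at_filter\<close>)
qed

lemma cont_to_bdry_tendsto:
  assumes "cont_to_bdry J I g" "t \<in> J" "a \<in> closure I"
  obtains L where "(g t \<longlongrightarrow> L) (at a within I)"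
  using assms continuous_extension_tendsto unfolding cont_to_bdry_def by metis

lemma cont_to_bdry_continuous_on:
  assumes "cont_to_bdry J I g" "t \<in> J"
  shows "continuous_on I (g t)"
  unfolding continuous_on_def
proof
  fix x assume x: "x \<in> I"
  obtain G where G: "continuous_on (J \<times> closure I) (\<lambda>(t, x). G t x)" "\<forall>t\<in>J. \<forall>x\<in>I. G t x = g t x"
    using assms(1) unfolding cont_to_bdry_def by blast
  have "(g t \<longlongrightarrow> G t x) (at x within I)"
    using x closure_subset by (intro continuous_extension_tendsto[OF G assms(2)]) auto
  then show "(g t \<longlongrightarrow> g t x) (at x within I)"
    using G(2) assms(2) x by simp
qed

lemma cont_to_bdry_bounded:
  assumes g: "cont_to_bdry J I g" and t: "t \<in> J" and K: "compact K" "K \<subseteq> closure I"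
  obtains C where "\<And>x. x \<in> K \<inter> I \<Longrightarrow> \<bar>g t x\<bar> \<le> C"
proof -
  obtain G where G: "continuous_on (J \<times> closure I) (\<lambda>(t, x). G t x)" "\<forall>t\<in>J. \<forall>x\<in>I. G t x = g t x"
    using g unfolding cont_to_bdry_def by blast
  have "continuous_on K (\<lambda>x. (\<lambda>(t, x). G t x) (t, x))"
    by (rule continuous_on_compose2[OF G(1)]) (use t K in \<open>auto intro!: continuous_intros\<close>)
  then have "continuous_on K (G t)" by simp
  then have "bounded (G t ` K)"
    using K compact_continuous_image compact_imp_bounded by blast
  then obtain C where "\<forall>x\<in>K. \<bar>G t x\<bar> \<le> C"
    unfolding bounded_iff by auto
  then show ?thesis
    using G(2) t by (intro that[of C]) auto
qed

lemma cont_decaying_traces: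
  assumes g: "cont_decaying J r l g" and t: "t \<in> J" and rl: "r < l"
  obtains gm gp where "(g t \<longlongrightarrow> gm) (at_left (-r))" "(g t \<longlongrightarrow> gp) (at_right r)"
proof -
  have c: "cont_to_bdry J (Em r) g" "cont_to_bdry J (Ep r l) g"
    using g by (auto simp: cont_decaying_def)
  obtain gm where "(g t \<longlongrightarrow> gm) (at (-r) within Em r)"
    by (rule cont_to_bdry_tendsto[OF c(1) t, of "-r"]) (auto simp: closure_Em)
  moreover obtain gp where "(g t \<longlongrightarrow> gp) (at r within Ep r l)"
    by (rule cont_to_bdry_tendsto[OF c(2) t, of r]) (use rl in \<open>auto simp: closure_Ep\<close>)
  ultimately show ?thesis
    using that at_within_Ep[OF rl] by (simp add: Em_def)
qed

text \<open>Compactness handles {N..-r} and {r..l}; beyond N the limit at minus infinity takes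
  over.\<close>

lemma cont_decaying_bounded:
  assumes g: "cont_decaying J r l g" and t: "t \<in> J" and rl: "r < l"
  obtains C where "\<And>x. x \<in> E r l \<Longrightarrow> \<bar>g t x\<bar> \<le> C"
proof -
  have c: "cont_to_bdry J (Em r) g" "cont_to_bdry J (Ep r l) g" and "(g t \<longlongrightarrow> 0) at_bot"
    using g t by (auto simp: cont_decaying_def)
  then have "eventually (\<lambda>x. \<bar>g t x\<bar> < 1) at_bot"
    using tendstoD[of "g t" 0 at_bot 1] by (simp add: dist_real_def)
  then obtain N where N: "\<And>x. x < N \<Longrightarrow> \<bar>g t x\<bar> < 1"
    unfolding eventually_at_bot_dense by blast
  obtain C1 where C1: "\<And>x. x \<in> {N..-r} \<inter> Em r \<Longrightarrow> \<bar>g t x\<bar> \<le> C1"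
    by (rule cont_to_bdry_bounded[OF c(1) t, of "{N..-r}"]) (auto simp: closure_Em)
  obtain C2 where C2: "\<And>x. x \<in> {r..l} \<inter> Ep r l \<Longrightarrow> \<bar>g t x\<bar> \<le> C2"
    by (rule cont_to_bdry_bounded[OF c(2) t, of "{r..l}"]) (use rl in \<open>auto simp: closure_Ep\<close>)
  show ?thesis
  proof (rule that)
    fix x assume "x \<in> E r l"
    then consider "x < N" | "x \<in> {N..-r} \<inter> Em r" | "x \<in> {r..l} \<inter> Ep r l"
      by (force simp: E_def Em_def Ep_def)
    then show "\<bar>g t x\<bar> \<le> max 1 (max C1 C2)"
    proof cases
      case 1 then show ?thesis using N[of x] by simp
    next
      case 2 then show ?thesis using C1[of x] by simp
    next
      case 3 then show ?thesis using C2[of x] by simp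
    qed
  qed
qed

lemma cont_decaying_sq_integrable:
  assumes g: "cont_decaying J r l g" and t: "t \<in> J" and rl: "r < l" and I: "I \<in> {Em r, Ep r l}"
  shows "sq_integrable I (g t)"
proof -
  obtain C where C: "\<And>x. x \<in> E r l \<Longrightarrow> \<bar>g t x\<bar> \<le> C"
    using cont_decaying_bounded[OF g t rl] by metis
  have "continuous_on (Ep r l) (g t)"
    using g t cont_to_bdry_continuous_on by (auto simp: cont_decaying_def)
  then have "sq_integrable (Ep r l) (g t)"
    by (rule sq_integrable_Ep_bounded) (use C in \<open>auto simp: E_def\<close>)
  moreover have "sq_integrable (Em r) (g t)"
    using g t by (auto simp: cont_decaying_def)
  ultimately show ?thesis using I by auto
qed

text \<open>Integrating in time and letting \<open>x\<close> tend to the boundary point exchanges the time derivative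
  with the trace.\<close>

lemma dt_trace:
  fixes f :: "real \<Rightarrow> real \<Rightarrow> real"
  assumes J: "J = {0..T}" and T: "0 < T"
    and diff: "\<And>t x. t \<in> J \<Longrightarrow> x \<in> I \<Longrightarrow> (\<lambda>s. f s x) differentiable (at t within J)"
    and f': "cont_to_bdry J I (dt J f)"
    and a: "a \<in> closure I" "at a within I \<noteq> bot"
    and b: "\<And>t. t \<in> J \<Longrightarrow> (f t \<longlongrightarrow> b t) (at a within I)"
    and t: "t \<in> J"
  shows "(dt J f t \<longlongrightarrow> vector_derivative b (at t within J)) (at a within I)"
proof -
  obtain G where G: "continuous_on (J \<times> closure I) (\<lambda>(t, x). G t x)"
    "\<forall>t\<in>J. \<forall>x\<in>I. G t x = dt J f t x"
    using f' unfolding cont_to_bdry_def by blast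
  have Gx: "continuous_on S (\<lambda>s. G s x)" if "x \<in> closure I" "S \<subseteq> J" for x S
  proof -
    have "continuous_on S (\<lambda>s. (\<lambda>(t, x). G t x) (s, x))"
      by (rule continuous_on_compose2[OF G(1)]) (use that in \<open>auto intro!: continuous_intros\<close>)
    then show ?thesis by simp
  qed
  \<comment> \<open>Differentiability of the trace \<open>b\<close> is obtained from this formula,
    which exhibits it as a primitive of a continuous function.\<close>
  have b_eq: "b s = b 0 + integral {0..s} (\<lambda>\<tau>. G \<tau> a)" if s: "s \<in> J" for s
  proof -
    have 0: "0 \<in> J" using J T by simp
    have sub: "{0..s} \<subseteq> J" using s J by auto
    have int: "integral {0..s} (\<lambda>\<tau>. G \<tau> x) = f s x - f 0 x" if x: "x \<in> I" for x
    proof (rule integral_unique, rule fundamental_theorem_of_calculus)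
      show "0 \<le> s" using s J by simp
      fix \<tau> assume "\<tau> \<in> {0..s}"
      then have \<tau>: "\<tau> \<in> J" using sub by auto
      have "((\<lambda>s. f s x) has_vector_derivative dt J f \<tau> x) (at \<tau> within J)"
        using diff[OF \<tau> x] unfolding dt_def by (simp add: vector_derivative_works)
      then show "((\<lambda>s. f s x) has_vector_derivative G \<tau> x) (at \<tau> within {0..s})"
        using has_vector_derivative_within_subset sub G(2) \<tau> x by fastforce
    qed
    have "continuous_on (closure I \<times> cbox 0 s) (\<lambda>(x, \<tau>). (\<lambda>(t, x). G t x) (\<tau>, x))"
      using continuous_on_compose2[OF G(1), of "closure I \<times> cbox 0 s" "\<lambda>(x, \<tau>). (\<tau>, x)"] sub
      by (force simp: split_beta intro!: continuous_intros)
    then have "continuous_on (closure I) (\<lambda>x. integral (cbox 0 s) (\<lambda>\<tau>. G \<tau> x))"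
      by (intro integral_continuous_on_param) simp
    then have "((\<lambda>x. integral {0..s} (\<lambda>\<tau>. G \<tau> x)) \<longlongrightarrow> integral {0..s} (\<lambda>\<tau>. G \<tau> a))
        (at a within closure I)"
      using a(1) by (simp add: continuous_on_def)
    then have "((\<lambda>x. integral {0..s} (\<lambda>\<tau>. G \<tau> x)) \<longlongrightarrow> integral {0..s} (\<lambda>\<tau>. G \<tau> a))
        (at a within I)"
      by (rule tendsto_within_subset) (rule closure_subset)
    then have "((\<lambda>x. f s x - f 0 x) \<longlongrightarrow> integral {0..s} (\<lambda>\<tau>. G \<tau> a)) (at a within I)"
      by (rule Lim_transform_eventually) (auto simp: eventually_at_filter int)
    moreover have "((\<lambda>x. f s x - f 0 x) \<longlongrightarrow> b s - b 0) (at a within I)"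
      by (intro tendsto_diff b s 0)
    ultimately have "integral {0..s} (\<lambda>\<tau>. G \<tau> a) = b s - b 0"
      using a(2) tendsto_unique by blast
    then show ?thesis by simp
  qed
  have "((\<lambda>s. b 0 + integral {0..s} (\<lambda>\<tau>. G \<tau> a)) has_vector_derivative 0 + G t a) (at t within {0..T})"
    using Gx[OF a(1), of "{0..T}"] J t
    by (intro has_vector_derivative_add has_vector_derivative_const integral_has_vector_derivative) auto
  then have "(b has_vector_derivative G t a) (at t within J)"
    using has_vector_derivative_transform[OF t b_eq] unfolding J by simp
  \<comment> \<open>The derivative within \<open>J\<close> is unique, also at its end points,
    because 0 < T.\<close>
  then have "vector_derivative b (at t within J) = G t a"
    using T t vector_derivative_within_closed_interval[of 0 T t b "G t a"] unfolding J by simp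
  then show ?thesis
    using continuous_extension_tendsto[OF G t a(1)] by simp
qed

section \<open>Algebra of jumps and traces at the contact points\<close>

lemma jump_eq:
  assumes "(G \<longlongrightarrow> gp) (at_right r)" "(G \<longlongrightarrow> gm) (at_left (-r))"
  shows "jump r G = gp - gm"
  unfolding jump_def using assms by (simp add: tendsto_Lim)

lemma mean_eq:
  assumes "(G \<longlongrightarrow> gp) (at_right r)" "(G \<longlongrightarrow> gm) (at_left (-r))"
  shows "mean r G = (gp + gm) / 2"
  unfolding mean_def using assms by (simp add: tendsto_Lim)

text \<open>Since exp = cosh + sinh and exp(-.) = cosh - sinh, the constants satisfy C1/2 + C2 =
  coth and C1/2 - C2 = 1. Sorting mean and jump by side therefore leaves coth at r and 1 at -r, a
  form in which positivity is visible and which matches the slopes of the lift.\<close>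

lemma calT_eq:
  assumes \<mu>: "0 < \<mu>" and rl: "r < l"
    and "(h \<longlongrightarrow> hp) (at_right r)" "(h \<longlongrightarrow> hm) (at_left (-r))" "hp \<noteq> 0" "hm \<noteq> 0"
  shows "calT \<mu> r l h = \<mu> * (cosh ((l - r) / \<mu>) / sinh ((l - r) / \<mu>) / hp + 1 / hm)"
proof -
  let ?L = "(l - r) / \<mu>"
  have "0 < ?L"
    using \<mu> rl by simp
  then have s: "sinh ?L \<noteq> 0"
    using sinh_real_pos_iff[of ?L] by linarith
  have "(c + s) / s / 2 + (c - s) / (2 * s) = c / s" "(c + s) / s / 2 - (c - s) / (2 * s) = 1"
    if "s \<noteq> 0" for c s :: real
    using that by (simp_all add: field_simps)
  from this[OF s, of "cosh ?L"] have "C1 \<mu> r l / 2 + C2 \<mu> r l = cosh ?L / sinh ?L" "C1 \<mu> r l / 2 - C2 \<mu> r l = 1"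
    unfolding C1_def C2_def
    unfolding sinh_plus_cosh[symmetric] cosh_minus_sinh[symmetric] by (simp_all add: add.commute)
  moreover have lim: "((\<lambda>x. 1 / h x) \<longlongrightarrow> 1 / hp) (at_right r)" "((\<lambda>x. 1 / h x) \<longlongrightarrow> 1 / hm) (at_left (-r))"
    using assms by (auto intro!: tendsto_intros)
  moreover have "calT \<mu> r l h = \<mu> * ((C1 \<mu> r l / 2 + C2 \<mu> r l) * (1 / hp) + (C1 \<mu> r l / 2 - C2 \<mu> r l) * (1 / hm))"
  proof -
    have "\<mu> * (a * ((x + y) / 2) + b * (x - y)) = \<mu> * ((a / 2 + b) * x + (a / 2 - b) * y)" for a b x y
      by (simp add: algebra_simps add_divide_distrib)
    then show ?thesis
      unfolding calT_def jump_eq[OF lim] mean_eq[OF lim] .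
  qed
  ultimately show ?thesis by simp
qed

text \<open>The left-hand side is the trace of \<open>\<zeta> + frakE\<close> and the first term on the right that of
  \<open>calF\<close>; \<open>a\<close> is the trace of \<open>\<partial>\<^sub>x\<partial>\<^sub>tq\<close> and \<open>d\<close> that of the slope of the Dirichlet lift.\<close>

lemma boundary_identity:
  fixes z h :: real
  assumes "h = 1 + \<epsilon> * z" "h \<noteq> 0"
  shows "z + (\<epsilon> * (Q\<^sup>2 / (2 * h\<^sup>2)) - \<mu>\<^sup>2 * (a / h))
    = 1 / h * (\<epsilon> * (z\<^sup>2 / 2) + (z + \<epsilon> * (z\<^sup>2 / 2) + \<epsilon> * (Q\<^sup>2 / h) + \<mu>\<^sup>2 * (d - a)))
      - \<epsilon> / 2 * (1 / h\<^sup>2) * Q\<^sup>2 - \<mu>\<^sup>2 * d / h"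
proof -
  \<comment> \<open>As h = 1 + \<epsilon> z, the product h z is z + \<epsilon> z^2. The primitive
    \<open>phi\<close> supplies only half of the square, and the extra \<epsilon> \<zeta>^2 / 2 in
    \<open>calF\<close> supplies the rest.\<close>
  have z: "z = 1 / h * (z + \<epsilon> * z\<^sup>2)"
    using assms by (simp add: field_simps power2_eq_square)
  have "\<epsilon> * (Q\<^sup>2 / (2 * h\<^sup>2)) = 1 / h * (\<epsilon> * (Q\<^sup>2 / h)) - \<epsilon> / 2 * (1 / h\<^sup>2) * Q\<^sup>2"
    using assms(2) by (simp add: field_simps power2_eq_square)
  moreover have "1 / h * (\<epsilon> * (z\<^sup>2 / 2) + (z + \<epsilon> * (z\<^sup>2 / 2) + \<epsilon> * (Q\<^sup>2 / h) + \<mu>\<^sup>2 * (d - a)))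
      = 1 / h * (z + \<epsilon> * z\<^sup>2) + 1 / h * (\<epsilon> * (Q\<^sup>2 / h)) + \<mu>\<^sup>2 * d / h - \<mu>\<^sup>2 * (a / h)"
    by (simp add: algebra_simps add_divide_distrib diff_divide_distrib)
  ultimately show ?thesis
    unfolding z[symmetric] by linarith
qed

text \<open>Each term is a bounded coefficient times \<zeta> or q; the lower bound \<open>h0\<close>
  keeps the coefficient q / h bounded.\<close>

lemma sq_integrable_phi:
  assumes \<zeta>: "cont_decaying J r l \<zeta>" and q: "cont_decaying J r l q" and t: "t \<in> J" and rl: "r < l"
    and h: "0 < h0" "\<And>x. x \<in> E r l \<Longrightarrow> h0 \<le> height \<epsilon> \<zeta> t x"
    and I: "I \<in> {Em r, Ep r l}"
  shows "sq_integrable I (phi \<epsilon> \<zeta> q t)"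
proof -
  have I': "open I" "I \<subseteq> E r l"
    using open_components[OF I] I by (auto simp: E_def)
  obtain Cz where Cz: "\<And>x. x \<in> E r l \<Longrightarrow> \<bar>\<zeta> t x\<bar> \<le> Cz"
    using cont_decaying_bounded[OF \<zeta> t rl] by metis
  obtain Cq where Cq: "\<And>x. x \<in> E r l \<Longrightarrow> \<bar>q t x\<bar> \<le> Cq"
    using cont_decaying_bounded[OF q t rl] by metis
  have c: "continuous_on I (\<zeta> t)" "continuous_on I (q t)"
    using \<zeta> q t I cont_to_bdry_continuous_on by (auto simp: cont_decaying_def)
  have ch: "continuous_on I (height \<epsilon> \<zeta> t)"
    unfolding height_def by (intro continuous_intros c)
  have hpos: "height \<epsilon> \<zeta> t x \<noteq> 0" if "x \<in> I" for x
    using h(1) h(2)[of x] I'(2) that by force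
  have "sq_integrable I (\<lambda>x. (1 + \<epsilon> / 2 * \<zeta> t x) * \<zeta> t x)"
  proof (rule sq_integrable_mult_bounded)
    show "set_borel_measurable lborel I (\<lambda>x. 1 + \<epsilon> / 2 * \<zeta> t x)"
      by (intro set_borel_measurable_continuous_on I' continuous_intros c)
    fix x assume "x \<in> I"
    then have "\<bar>\<epsilon> / 2 * \<zeta> t x\<bar> \<le> \<bar>\<epsilon> / 2\<bar> * Cz"
      using Cz[of x] I'(2) unfolding abs_mult by (intro mult_left_mono) auto
    then show "\<bar>1 + \<epsilon> / 2 * \<zeta> t x\<bar> \<le> 1 + \<bar>\<epsilon> / 2\<bar> * Cz"
      by linarith
  qed (rule cont_decaying_sq_integrable[OF \<zeta> t rl I])
  moreover have "sq_integrable I (\<lambda>x. (\<epsilon> * q t x / height \<epsilon> \<zeta> t x) * q t x)"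
  proof (rule sq_integrable_mult_bounded)
    show "set_borel_measurable lborel I (\<lambda>x. \<epsilon> * q t x / height \<epsilon> \<zeta> t x)"
      by (intro set_borel_measurable_continuous_on I' continuous_intros c ch) (simp add: hpos)
    fix x assume x: "x \<in> I"
    then have "\<bar>\<epsilon> * q t x\<bar> \<le> \<bar>\<epsilon>\<bar> * Cq"
      using Cq[of x] I'(2) unfolding abs_mult by (intro mult_left_mono) auto
    moreover have "h0 \<le> \<bar>height \<epsilon> \<zeta> t x\<bar>"
      using h(2)[of x] x I'(2) by force
    ultimately show "\<bar>\<epsilon> * q t x / height \<epsilon> \<zeta> t x\<bar> \<le> \<bar>\<epsilon>\<bar> * Cq / h0"
      unfolding abs_divide using h(1) by (intro frac_le) auto
  qed (rule cont_decaying_sq_integrable[OF q t rl I])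
  ultimately have "sq_integrable I (\<lambda>x. (1 + \<epsilon> / 2 * \<zeta> t x) * \<zeta> t x
      + (\<epsilon> * q t x / height \<epsilon> \<zeta> t x) * q t x)"
    by (rule sq_integrable_add)
  moreover have "(\<lambda>x. (1 + \<epsilon> / 2 * \<zeta> t x) * \<zeta> t x + (\<epsilon> * q t x / height \<epsilon> \<zeta> t x) * q t x)
      = phi \<epsilon> \<zeta> q t"
    by (simp add: phi_def algebra_simps power2_eq_square fun_eq_iff)
  ultimately show ?thesis by simp
qed

section \<open>The equivalence of the two formulations\<close>

theorem proposition4p7:
  fixes \<epsilon> \<mu> r l hw \<alpha> P0 \<kappa> T :: real
    and J :: "real set"
    and \<zeta> q h :: "real \<Rightarrow> real \<Rightarrow> real"
    and qi :: "real \<Rightarrow> real"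
  assumes "0 < \<epsilon>" "\<epsilon> \<le> 1" "0 \<le> \<mu>" "0 < r" "r < l"
    and "0 < hw" "\<alpha> = 2 * r / hw" "0 < P0" "0 \<le> \<kappa>"
    and "0 < T" "J = {0..T}"
    and regular: "regular J r l \<zeta>" "regular J r l q" "\<mu> \<noteq> 0 \<Longrightarrow> regular_disp J r l q"
      "qi differentiable_on J"
    and h: "h = height \<epsilon> \<zeta>"
    \<comment> \<open>positivity of \<open>h\<close> up to the boundary (\<open>h\<close> tends to 1 at minus infinity)\<close>
    and h_pos: "\<And>t. t \<in> J \<Longrightarrow> \<exists>h0>0. \<forall>x\<in>E r l. h0 \<le> h t x"
    and mass: "\<And>t x. t \<in> J \<Longrightarrow> x \<in> E r l \<Longrightarrow> dt J \<zeta> t x + dx q t x = 0"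
    and momentum: "\<And>t x. t \<in> J \<Longrightarrow> x \<in> E r l \<Longrightarrow>
        (dt J q t x - \<mu>\<^sup>2 * dx (dx (dt J q)) t x)
        + \<epsilon> * dx (\<lambda>t x. (q t x)\<^sup>2 / h t x) t x + h t x * dx \<zeta> t x = 0"
    and at_infinity: "\<And>t. t \<in> J \<Longrightarrow> (\<zeta> t \<longlongrightarrow> 0) at_bot" "\<And>t. t \<in> J \<Longrightarrow> (q t \<longlongrightarrow> 0) at_bot"
    and wall: "\<And>t. t \<in> J \<Longrightarrow> (q t \<longlongrightarrow> 0) (at_left l)"
    and transmission: "\<And>t. t \<in> J \<Longrightarrow> jump r (q t) = 0" "\<And>t. t \<in> J \<Longrightarrow> mean r (q t) = qi t"
  shows
    "(\<mu> = 0 \<longrightarrow> (\<forall>t\<in>J.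
        \<alpha> * vector_derivative qi (at t within J)
          = - jump r (\<lambda>x. \<zeta> t x + frakE J \<epsilon> \<mu> \<zeta> q t x)
            - P0 * (avg r l \<zeta> t - \<kappa> * D \<kappa> (avg r l \<zeta>) t)
        \<longleftrightarrow>
        \<alpha> * vector_derivative qi (at t within J) + \<epsilon> / 2 * jump r (\<lambda>x. 1 / (h t x)\<^sup>2) * (qi t)\<^sup>2
          = - jump r (\<zeta> t) - P0 * (avg r l \<zeta> t - \<kappa> * D \<kappa> (avg r l \<zeta>) t))) \<and>
     (\<mu> \<noteq> 0 \<longrightarrow> (\<forall>t\<in>J.
        calT \<mu> r l (h t) > 0 \<and>
        (\<alpha> * vector_derivative qi (at t within J)
          = - jump r (\<lambda>x. \<zeta> t x + frakE J \<epsilon> \<mu> \<zeta> q t x)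
            - P0 * (avg r l \<zeta> t - \<kappa> * D \<kappa> (avg r l \<zeta>) t)
        \<longleftrightarrow>
        (\<alpha> + calT \<mu> r l (h t)) * vector_derivative qi (at t within J)
            - \<epsilon> / 2 * jump r (\<lambda>x. 1 / (h t x)\<^sup>2) * (qi t)\<^sup>2
          = - jump r (calF \<epsilon> \<mu> r l \<zeta> q t)
            - P0 * (avg r l \<zeta> t - \<kappa> * D \<kappa> (avg r l \<zeta>) t))))"
proof -
  let ?E = "\<lambda>t. \<alpha> * vector_derivative qi (at t within J)
      = - jump r (\<lambda>x. \<zeta> t x + frakE J \<epsilon> \<mu> \<zeta> q t x)
        - P0 * (avg r l \<zeta> t - \<kappa> * D \<kappa> (avg r l \<zeta>) t)"
  note r = \<open>0 < r\<close> \<open>r < l\<close>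
  have cd: "cont_decaying J r l \<zeta>" "cont_decaying J r l q" "cont_decaying J r l (dt J q)"
    using regular by (auto simp: regular_def)
  \<comment> \<open>\<open>jump\<close> and \<open>mean\<close> are built from the total operator
    \<open>Lim\<close>, so the traces must be known to exist before the transmission conditions can
    determine them.\<close>
  have q_trace: "(q t \<longlongrightarrow> qi t) (at_left (-r))" "(q t \<longlongrightarrow> qi t) (at_right r)" if t: "t \<in> J" for t
  proof -
    obtain qm qp where tr: "(q t \<longlongrightarrow> qm) (at_left (-r))" "(q t \<longlongrightarrow> qp) (at_right r)"
      by (rule cont_decaying_traces[OF cd(2) t r(2)])
    have "qp - qm = 0" "(qp + qm) / 2 = qi t"
      using transmission[OF t] jump_eq[OF tr(2,1)] mean_eq[OF tr(2,1)] by simp_all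
    then have "qp = qi t" "qm = qi t" by simp_all
    with tr show "(q t \<longlongrightarrow> qi t) (at_left (-r))" "(q t \<longlongrightarrow> qi t) (at_right r)" by simp_all
  qed
  have h_traces: "(h t \<longlongrightarrow> 1 + \<epsilon> * zm) (at_left (-r))" "(h t \<longlongrightarrow> 1 + \<epsilon> * zp) (at_right r)"
      "0 < 1 + \<epsilon> * zm" "0 < 1 + \<epsilon> * zp"
    if t: "t \<in> J" and z: "(\<zeta> t \<longlongrightarrow> zm) (at_left (-r))" "(\<zeta> t \<longlongrightarrow> zp) (at_right r)" for t zm zp
  proof -
    show lim: "(h t \<longlongrightarrow> 1 + \<epsilon> * zm) (at_left (-r))" "(h t \<longlongrightarrow> 1 + \<epsilon> * zp) (at_right r)"
      unfolding h height_def by (intro tendsto_intros z)+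
    obtain h0 where h0: "0 < h0" "\<And>x. x \<in> E r l \<Longrightarrow> h0 \<le> h t x"
      using h_pos[OF t] by blast
    \<comment> \<open>A strict inequality could degenerate in the limit; the uniform bound
      \<open>h0\<close> cannot.\<close>
    have "h0 \<le> 1 + \<epsilon> * zm"
      by (rule tendsto_lowerbound[OF lim(1)], rule eventually_mono[OF eventually_E(2)[OF r(2)]])
        (auto simp: h0)
    moreover have "h0 \<le> 1 + \<epsilon> * zp"
      by (rule tendsto_lowerbound[OF lim(2)], rule eventually_mono[OF eventually_E(3)[OF r(2)]])
        (auto simp: h0)
    ultimately show "0 < 1 + \<epsilon> * zm" "0 < 1 + \<epsilon> * zp"
      using h0(1) by linarith+
  qed
  have J: "J = {0..T}" and T: "0 < T" by fact+
  show ?thesis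
  proof (rule conjI; intro impI ballI)
    fix t assume \<mu>0: "\<mu> = 0" and t: "t \<in> J"
    obtain zm zp where z: "(\<zeta> t \<longlongrightarrow> zm) (at_left (-r))" "(\<zeta> t \<longlongrightarrow> zp) (at_right r)"
      by (rule cont_decaying_traces[OF cd(1) t r(2)])
    note h_trace = h_traces[OF t z]
    have E_jump: "jump r (\<lambda>x. \<zeta> t x + frakE J \<epsilon> \<mu> \<zeta> q t x)
        = (zp + \<epsilon> * ((qi t)\<^sup>2 / (2 * (1 + \<epsilon> * zp)\<^sup>2))) - (zm + \<epsilon> * ((qi t)\<^sup>2 / (2 * (1 + \<epsilon> * zm)\<^sup>2)))"
      unfolding frakE_def h[symmetric] \<mu>0 using h_trace(3,4)
      by (intro jump_eq) (auto intro!: tendsto_intros z q_trace t h_trace)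
    have h2_jump: "jump r (\<lambda>x. 1 / (h t x)\<^sup>2) = 1 / (1 + \<epsilon> * zp)\<^sup>2 - 1 / (1 + \<epsilon> * zm)\<^sup>2"
      using h_trace(3,4) by (intro jump_eq tendsto_intros h_trace) auto
    have "jump r (\<lambda>x. \<zeta> t x + frakE J \<epsilon> \<mu> \<zeta> q t x)
        = jump r (\<zeta> t) + \<epsilon> / 2 * jump r (\<lambda>x. 1 / (h t x)\<^sup>2) * (qi t)\<^sup>2"
      unfolding E_jump h2_jump jump_eq[OF z(2,1)] by (simp add: algebra_simps diff_divide_distrib)
    then show "?E t \<longleftrightarrow> \<alpha> * vector_derivative qi (at t within J)
          + \<epsilon> / 2 * jump r (\<lambda>x. 1 / (h t x)\<^sup>2) * (qi t)\<^sup>2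
        = - jump r (\<zeta> t) - P0 * (avg r l \<zeta> t - \<kappa> * D \<kappa> (avg r l \<zeta>) t)"
      by (intro iffI; linarith)
  next
    fix t assume "\<mu> \<noteq> 0" and t: "t \<in> J"
    with \<open>0 \<le> \<mu>\<close> have \<mu>: "0 < \<mu>" by simp
    have reg: "cont_decaying J r l (dx (dt J q))"
      "\<And>x. x \<in> E r l \<Longrightarrow> dt J q t differentiable (at x) \<and> dx (dt J q) t differentiable (at x)"
      using regular(3)[OF \<open>\<mu> \<noteq> 0\<close>] t by (auto simp: regular_disp_def)
    obtain zm zp where z: "(\<zeta> t \<longlongrightarrow> zm) (at_left (-r))" "(\<zeta> t \<longlongrightarrow> zp) (at_right r)"
      by (rule cont_decaying_traces[OF cd(1) t r(2)])
    obtain am ap where a: "(dx (dt J q) t \<longlongrightarrow> am) (at_left (-r))" "(dx (dt J q) t \<longlongrightarrow> ap) (at_right r)"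
      by (rule cont_decaying_traces[OF reg(1) t r(2)])
    note h_trace = h_traces[OF t z]
    let ?hp = "1 + \<epsilon> * zp" and ?hm = "1 + \<epsilon> * zm"
    define c where "c = vector_derivative qi (at t within J)"
    define k where "k = cosh ((l - r) / \<mu>) / sinh ((l - r) / \<mu>)"
    have "0 < k"
      unfolding k_def using \<mu> r by (intro divide_pos_pos) auto
    have T_eq: "calT \<mu> r l (h t) = \<mu> * (k / ?hp + 1 / ?hm)"
      unfolding k_def using h_trace(3,4) by (intro calT_eq \<mu> r h_trace) auto
    have p_lim: "(dt J q t \<longlongrightarrow> 0) at_bot" "(dt J q t \<longlongrightarrow> c) (at_left (-r))"
      "(dt J q t \<longlongrightarrow> c) (at_right r)" "(dt J q t \<longlongrightarrow> 0) (at_left l)"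
    proof -
      show "(dt J q t \<longlongrightarrow> 0) at_bot"
        using cd(3) t by (simp add: cont_decaying_def)
      have diff: "(\<lambda>s. q s x) differentiable (at t within J)" if "t \<in> J" "x \<in> E r l" for t x
        using regular(2) that by (simp add: regular_def)
      have bdry: "cont_to_bdry J (Em r) (dt J q)" "cont_to_bdry J (Ep r l) (dt J q)"
        using cd(3) by (auto simp: cont_decaying_def)
      have "(dt J q t \<longlongrightarrow> c) (at (-r) within Em r)"
        unfolding c_def
        by (rule dt_trace[OF J T diff bdry(1) _ _ _ t]) (auto simp: E_def closure_Em Em_def q_trace)
      then show "(dt J q t \<longlongrightarrow> c) (at_left (-r))"
        by (simp add: Em_def)
      have "(dt J q t \<longlongrightarrow> c) (at r within Ep r l)"
        unfolding c_def
        by (rule dt_trace[OF J T diff bdry(2) _ _ _ t])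
          (use r in \<open>auto simp: E_def closure_Ep at_within_Ep q_trace\<close>)
      then show "(dt J q t \<longlongrightarrow> c) (at_right r)"
        using r by (simp add: at_within_Ep)
      \<comment> \<open>At the wall the trace of q is zero for all times, so the trace function to
        be differentiated is constant.\<close>
      have "(dt J q t \<longlongrightarrow> vector_derivative (\<lambda>_. 0) (at t within J)) (at l within Ep r l)"
        by (rule dt_trace[OF J T diff bdry(2) _ _ _ t])
          (use r in \<open>auto simp: E_def closure_Ep at_within_Ep wall\<close>)
      moreover have "vector_derivative (\<lambda>_. 0::real) (at t within J) = 0"
        using vector_derivative_within_closed_interval[OF T _ has_vector_derivative_const] t J by simp
      ultimately show "(dt J q t \<longlongrightarrow> 0) (at_left l)"
        using r by (simp add: at_within_Ep)
    qed
    obtain h0 where h0: "0 < h0" "\<And>x. x \<in> E r l \<Longrightarrow> h0 \<le> h t x"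
      using h_pos[OF t] by blast
    have R1_phi: "R1 \<mu> r l (phi \<epsilon> \<zeta> q t) x
        = phi \<epsilon> \<zeta> q t x + \<mu>\<^sup>2 * (dirichlet_lift' \<mu> r l c x - dx (dt J q) t x)" if x: "x \<in> E r l" for x
    proof (rule R1_from_dispersive[OF \<mu> r _ _ _ _ p_lim x])
      fix y assume y: "y \<in> E r l"
      show "(dt J q t has_real_derivative dx (dt J q) t y) (at y)"
        "(dx (dt J q) t has_real_derivative dx (dx (dt J q)) t y) (at y)"
        using reg(2)[OF y] unfolding dx_def by (auto simp: DERIV_deriv_iff_real_differentiable)
      have dz: "(\<zeta> t has_real_derivative dx \<zeta> t y) (at y)" and dq: "(q t has_real_derivative dx q t y) (at y)"
        using regular(1,2) t y unfolding dx_def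
        by (auto simp: regular_def DERIV_deriv_iff_real_differentiable)
      have "((\<lambda>x. 1 + \<epsilon> * \<zeta> t x) has_real_derivative 0 + \<epsilon> * dx \<zeta> t y) (at y)"
        by (intro DERIV_add DERIV_const DERIV_cmult dz)
      then have dh: "(h t has_real_derivative \<epsilon> * dx \<zeta> t y) (at y)"
        by (simp add: h height_def[abs_def])
      have "((\<lambda>x. (q t x)\<^sup>2 / h t x) differentiable (at y))"
        using DERIV_divide[OF DERIV_power[OF dq, of 2] dh] h0(1) h0(2)[OF y]
        by (auto simp: real_differentiable_def)
      then have df: "((\<lambda>x. (q t x)\<^sup>2 / h t x) has_real_derivative dx (\<lambda>t x. (q t x)\<^sup>2 / h t x) t y) (at y)"
        unfolding dx_def by (simp add: DERIV_deriv_iff_real_differentiable)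
      have "((\<lambda>x. \<zeta> t x + \<epsilon> * ((\<zeta> t x)\<^sup>2 / 2) + \<epsilon> * ((q t x)\<^sup>2 / h t x)) has_real_derivative
          dx \<zeta> t y + \<epsilon> * (\<zeta> t y * dx \<zeta> t y) + \<epsilon> * dx (\<lambda>t x. (q t x)\<^sup>2 / h t x) t y) (at y)"
        using DERIV_cdivide[OF DERIV_power[OF dz, of 2], of 2]
        by (intro DERIV_add dz DERIV_cmult df) (simp add: mult.commute)
      moreover have "dx \<zeta> t y + \<epsilon> * (\<zeta> t y * dx \<zeta> t y) = h t y * dx \<zeta> t y"
        by (simp add: h height_def algebra_simps)
      moreover have "(\<lambda>x. \<zeta> t x + \<epsilon> * ((\<zeta> t x)\<^sup>2 / 2) + \<epsilon> * ((q t x)\<^sup>2 / h t x)) = phi \<epsilon> \<zeta> q t"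
        by (simp add: phi_def h fun_eq_iff)
      ultimately have "(phi \<epsilon> \<zeta> q t has_real_derivative
          h t y * dx \<zeta> t y + \<epsilon> * dx (\<lambda>t x. (q t x)\<^sup>2 / h t x) t y) (at y)"
        by simp
      moreover have "h t y * dx \<zeta> t y + \<epsilon> * dx (\<lambda>t x. (q t x)\<^sup>2 / h t x) t y
          = \<mu>\<^sup>2 * dx (dx (dt J q)) t y - dt J q t y"
        using momentum[OF t y] by simp
      ultimately show "(phi \<epsilon> \<zeta> q t has_real_derivative \<mu>\<^sup>2 * dx (dx (dt J q)) t y - dt J q t y) (at y)"
        by simp
    next
      fix I assume I: "I \<in> {Em r, Ep r l}"
      show "sq_integrable I (dt J q t) \<and> sq_integrable I (dx (dt J q) t) \<and> sq_integrable I (phi \<epsilon> \<zeta> q t)"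
        using cont_decaying_sq_integrable[OF cd(3) t r(2) I] cont_decaying_sq_integrable[OF reg(1) t r(2) I]
          sq_integrable_phi[OF cd(1,2) t r(2) h0(1) _ I, of \<epsilon>] h0(2) unfolding h by blast
    qed
    have F_eq: "calF \<epsilon> \<mu> r l \<zeta> q t x = 1 / h t x * (\<epsilon> * ((\<zeta> t x)\<^sup>2 / 2)
        + (\<zeta> t x + \<epsilon> * ((\<zeta> t x)\<^sup>2 / 2) + \<epsilon> * ((q t x)\<^sup>2 / h t x)
        + \<mu>\<^sup>2 * (dirichlet_lift' \<mu> r l c x - dx (dt J q) t x)))" if "x \<in> E r l" for x
      by (simp add: calF_def R1_phi[OF that] phi_def h)
    \<comment> \<open>The trace of \<open>calF\<close> is kept in the shape of
      \<open>boundary_identity\<close>; \<open>d\<close> is \<open>?dp\<close> on the right and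
      \<open>c / \<mu>\<close> on the left.\<close>
    let ?F = "\<lambda>h z d a. 1 / h * (\<epsilon> * (z\<^sup>2 / 2)
        + (z + \<epsilon> * (z\<^sup>2 / 2) + \<epsilon> * ((qi t)\<^sup>2 / h) + \<mu>\<^sup>2 * (d - a)))"
    let ?dp = "- (c / \<mu>) * cosh ((l - r) / \<mu>) / sinh ((l - r) / \<mu>)"
    have "(calF \<epsilon> \<mu> r l \<zeta> q t \<longlongrightarrow> ?F ?hp zp ?dp ap) (at_right r)"
      by (rule tendsto_eq_on[OF _ F_eq eventually_E(3)[OF r(2)] refl])
        (intro tendsto_intros z a h_trace q_trace t dirichlet_lift_limits \<mu> r;
          use h_trace(3,4) in simp)
    moreover have "(calF \<epsilon> \<mu> r l \<zeta> q t \<longlongrightarrow> ?F ?hm zm (c / \<mu>) am) (at_left (-r))"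
      by (rule tendsto_eq_on[OF _ F_eq eventually_E(2)[OF r(2)] refl])
        (intro tendsto_intros z a h_trace q_trace t dirichlet_lift_limits \<mu> r;
          use h_trace(3,4) in simp)
    ultimately have F_jump: "jump r (calF \<epsilon> \<mu> r l \<zeta> q t) = ?F ?hp zp ?dp ap - ?F ?hm zm (c / \<mu>) am"
      by (rule jump_eq)
    let ?e = "\<lambda>h z a. z + (\<epsilon> * ((qi t)\<^sup>2 / (2 * h\<^sup>2)) - \<mu>\<^sup>2 * (a / h))"
    have E_jump: "jump r (\<lambda>x. \<zeta> t x + frakE J \<epsilon> \<mu> \<zeta> q t x) = ?e ?hp zp ap - ?e ?hm zm am"
      unfolding frakE_def h[symmetric]
      by (intro jump_eq tendsto_intros z a h_trace q_trace t; use h_trace(3,4) in simp)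
    have h2_jump: "jump r (\<lambda>x. 1 / (h t x)\<^sup>2) = 1 / ?hp\<^sup>2 - 1 / ?hm\<^sup>2"
      using h_trace(3,4) by (intro jump_eq tendsto_intros h_trace) auto
    have "?e ?hp zp ap = ?F ?hp zp ?dp ap - \<epsilon> / 2 * (1 / ?hp\<^sup>2) * (qi t)\<^sup>2 - \<mu>\<^sup>2 * ?dp / ?hp"
      "?e ?hm zm am = ?F ?hm zm (c / \<mu>) am - \<epsilon> / 2 * (1 / ?hm\<^sup>2) * (qi t)\<^sup>2 - \<mu>\<^sup>2 * (c / \<mu>) / ?hm"
      by (rule boundary_identity; use h_trace(3,4) in simp)+
    \<comment> \<open>For positive \<open>c\<close> the lift rises towards -r and falls away from r.
      These opposite slopes make the two contributions add up in the jump instead of cancelling,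
      which gives the added mass.\<close>
    moreover have "- (\<mu>\<^sup>2 * ?dp / ?hp) + \<mu>\<^sup>2 * (c / \<mu>) / ?hm = calT \<mu> r l (h t) * c"
      unfolding T_eq k_def using \<mu> by (simp add: power2_eq_square algebra_simps)
    moreover have "\<epsilon> / 2 * jump r (\<lambda>x. 1 / (h t x)\<^sup>2) * (qi t)\<^sup>2
        = \<epsilon> / 2 * (1 / ?hp\<^sup>2) * (qi t)\<^sup>2 - \<epsilon> / 2 * (1 / ?hm\<^sup>2) * (qi t)\<^sup>2"
      unfolding h2_jump by (simp add: algebra_simps)
    ultimately have key: "jump r (\<lambda>x. \<zeta> t x + frakE J \<epsilon> \<mu> \<zeta> q t x) = jump r (calF \<epsilon> \<mu> r l \<zeta> q t)
        - \<epsilon> / 2 * jump r (\<lambda>x. 1 / (h t x)\<^sup>2) * (qi t)\<^sup>2 + calT \<mu> r l (h t) * c"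
      unfolding F_jump E_jump by linarith
    have "0 < calT \<mu> r l (h t)"
      unfolding T_eq using \<mu> \<open>0 < k\<close> h_trace(3,4)
      by (intro mult_pos_pos[OF \<mu>] add_pos_pos[OF divide_pos_pos divide_pos_pos]) auto
    \<comment> \<open>Once the factor \<alpha> + \<open>calT\<close> is distributed,
      \<open>key\<close> makes the two equations linear rearrangements of each other, with the
      remaining products as atoms.\<close>
    moreover have "?E t \<longleftrightarrow> (\<alpha> + calT \<mu> r l (h t)) * vector_derivative qi (at t within J)
          - \<epsilon> / 2 * jump r (\<lambda>x. 1 / (h t x)\<^sup>2) * (qi t)\<^sup>2
        = - jump r (calF \<epsilon> \<mu> r l \<zeta> q t) - P0 * (avg r l \<zeta> t - \<kappa> * D \<kappa> (avg r l \<zeta>) t)"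
      unfolding key c_def[symmetric] distrib_right by (intro iffI; linarith)
    ultimately show "calT \<mu> r l (h t) > 0 \<and> (?E t \<longleftrightarrow>
        (\<alpha> + calT \<mu> r l (h t)) * vector_derivative qi (at t within J)
          - \<epsilon> / 2 * jump r (\<lambda>x. 1 / (h t x)\<^sup>2) * (qi t)\<^sup>2
        = - jump r (calF \<epsilon> \<mu> r l \<zeta> q t) - P0 * (avg r l \<zeta> t - \<kappa> * D \<kappa> (avg r l \<zeta>) t))"
      by blast
  qed
qed

end
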